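(* The online mark-and-choose procedure is forward proportional, immediately envy free, weakly truthful, surjective, and scale invariant. However, it is not proportional, not envy free, not forward envy free, not equitable, not Pareto optimal, not weakly Pareto optimal, not truthful, not order monotonic and not sequential.
   Context: Cake and valuations. The cake is the unit interval $[0,1]$, to be divided between $n$ players. Each player has an additive and continuous valuation function on the intervals (or unions of intervals) they may be allocated. Different players need not assign the same value to the whole cake. The players arrive one after another in a given order, are allocated cake, and depart; at least one player departs before the last player arrives (so $n\ge3$ for the procedure below). The number $n$ of players is known. Each player is ignorant of the valuation functions of the other players and is risk averse: they maximize the minimum value of the cake they will receive, regardless of what the other players do. Online mark-and-choose procedure. The first player to arrive marks the cake into $n$ pieces. The second player to arrive selects one piece to give to the first player, who then departs. The second player then marks the remaining cake into $n-1$ pieces and waits for the third player to arrive. The procedure repeats in this way until the last player arrives. The last player to arrive selects which of the two pieces marked by the penultimate player should be allocated to the penultimate player, and then takes whatever remains. Pieces need not be continuous slices: a marked piece may consist of several intervals. Being risk averse, a player marking the remaining cake marks it into pieces of equal value to them, and a player selecting a piece for another player selects a piece of least value to themselves (choosing arbitrarily between equally least valuable pieces). Telling the truth means acting in this way according to one's true valuation. Properties of a cake cutting procedure (the procedure has a property if it holds whatever the players' valuation functions are, except that surjectivity is quantified as stated). Proportional: each of the $n$ players assigns at least $\frac1n$ of the total value to their piece(s). Forward proportional: each player assigns at least $\frac{r}{n-k}$ of the total value of the cake to their pieces, where $r$ is the fraction of the total value assigned by the player to the remaining (not yet allocated) cake when they arrive and $k$ is the number of players who have already left at this point. Envy free: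 no player values another player's pieces more than their own. Forward envy free: no player values the pieces of cake allocated to other players after their arrival more than their own. Immediately envy free: no player values the pieces of cake allocated to another player after their arrival and before their departure more than their own. Equitable: all players assign the same value to the pieces of cake they are allocated. Pareto optimal: there is no other allocation to the one returned that is more valuable for one player and at least as valuable for the others. Weakly Pareto optimal: there is no other allocation to the one returned that is more valuable for all players. Weakly truthful: a player will do at least as well by telling the truth whatever valuations are held by the other players. Truthful: there are no valuations where a player will do better by lying (even when they know how the others value the cake). Surjective: for every possible partition of the cake into $n$ pieces, each one continuous slice, there are valuation functions for the players such that the procedure allocates these slices, one to each player (which player receives a particular slice is ignored). Scale invariant: the allocation of cake is unchanged when a player's valuation is uniformly multiplied by a constant factor. Sequential: the slice given to any player is to the left of any slice given to a player who is later to depart. Order monotonic: a player's valuation of their cake does not decrease when they are moved earlier in the arrival ordering (all other players having the same arrival ordering). *)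

theory Defs
  imports "HOL-Analysis.Analysis"
begin

section \<open>Cake, pieces and valuations\<close>

abbreviation cake :: "real set" where
  "cake \<equiv> {0..1}"

definition piece :: "real set \<Rightarrow> bool" where
  "piece P \<longleftrightarrow> P \<subseteq> cake \<and> (\<exists>I. finite I \<and> (\<forall>J\<in>I. is_interval J) \<and> P = \<Union>I)"

text \<open>
  Pieces are lists rather than sets of sets because several empty pieces may be marked
  (for instance by a player to whom the remaining cake is worthless).
\<close>

definition divides :: "real set \<Rightarrow> nat \<Rightarrow> real set list \<Rightarrow> bool" where
  "divides R m Ps \<longleftrightarrow> length Ps = m \<and> (\<forall>P\<in>set Ps. piece P) \<and>
     disjoint_family_on (\<lambda>i. Ps ! i) {..<m} \<and> \<Union>(set Ps) = R"

type_synonym valuation = "real set \<Rightarrow> real"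

text \<open>
  Continuity is joint in both end points of an interval; together with additivity this makes
  single points worthless, including the points 0 and 1. The value of the whole cake is positive,
  so that fractions of the total value make sense, but it is not normalized.
\<close>

definition is_valuation :: "valuation \<Rightarrow> bool" where
  "is_valuation v \<longleftrightarrow>
     (\<forall>P. piece P \<longrightarrow> 0 \<le> v P) \<and>
     (\<forall>P Q. piece P \<and> piece Q \<and> P \<inter> Q = {} \<longrightarrow> v (P \<union> Q) = v P + v Q) \<and>
     continuous_on {(a, b). 0 \<le> a \<and> a \<le> b \<and> b \<le> 1} (\<lambda>(a, b). v {a..b}) \<and>
     0 < v cake"

section \<open>Cake cutting procedures\<close>

text \<open>
  Players are numbered from 0 in order of arrival. The way in which a player acts is a strategy,
  and a procedure returns an allocation for every profile of strategies. Truthful behaviour need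
  not be unique (there are many divisions into pieces of equal value, and ties among least
  valuable pieces), so it is a relation honest between valuations and strategies.
  The numbers arrives i and departs i are points in time; a player receives
  cake when departing.
\<close>

record 's procedure =
  players :: nat
  arrives :: "nat \<Rightarrow> nat"
  departs :: "nat \<Rightarrow> nat"
  legal :: "'s \<Rightarrow> bool"
  honest :: "valuation \<Rightarrow> 's \<Rightarrow> bool"
  alloc :: "(nat \<Rightarrow> 's) \<Rightarrow> nat \<Rightarrow> real set"

definition honest_profile ::
    "('s, 'z) procedure_scheme \<Rightarrow> (nat \<Rightarrow> valuation) \<Rightarrow> (nat \<Rightarrow> 's) \<Rightarrow> bool" where
  "honest_profile p V \<sigma> \<longleftrightarrow> (\<forall>i<players p. is_valuation (V i) \<and> honest p (V i) (\<sigma> i))"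

definition proportional :: "('s, 'z) procedure_scheme \<Rightarrow> bool" where
  "proportional p \<longleftrightarrow> (\<forall>V \<sigma>. honest_profile p V \<sigma> \<longrightarrow>
     (\<forall>i<players p. V i (alloc p \<sigma> i) \<ge> 1 / real (players p) * V i cake))"

definition left_before :: "('s, 'z) procedure_scheme \<Rightarrow> nat \<Rightarrow> nat set" where
  "left_before p i = {j. j < players p \<and> departs p j < arrives p i}"

definition forward_proportional :: "('s, 'z) procedure_scheme \<Rightarrow> bool" where
  "forward_proportional p \<longleftrightarrow> (\<forall>V \<sigma>. honest_profile p V \<sigma> \<longrightarrow>
     (\<forall>i<players p.
        let k = card (left_before p i);
            r = V i (cake - (\<Union>j\<in>left_before p i. alloc p \<sigma> j)) / V i cake
        in V i (alloc p \<sigma> i) \<ge> r / (real (players p) - real k) * V i cake))"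

definition envy_free :: "('s, 'z) procedure_scheme \<Rightarrow> bool" where
  "envy_free p \<longleftrightarrow> (\<forall>V \<sigma>. honest_profile p V \<sigma> \<longrightarrow>
     (\<forall>i<players p. \<forall>j<players p. V i (alloc p \<sigma> j) \<le> V i (alloc p \<sigma> i)))"

definition forward_envy_free :: "('s, 'z) procedure_scheme \<Rightarrow> bool" where
  "forward_envy_free p \<longleftrightarrow> (\<forall>V \<sigma>. honest_profile p V \<sigma> \<longrightarrow>
     (\<forall>i<players p. \<forall>j<players p. arrives p i < departs p j \<longrightarrow>
        V i (alloc p \<sigma> j) \<le> V i (alloc p \<sigma> i)))"

definition immediately_envy_free :: "('s, 'z) procedure_scheme \<Rightarrow> bool" where
  "immediately_envy_free p \<longleftrightarrow> (\<forall>V \<sigma>. honest_profile p V \<sigma> \<longrightarrow>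
     (\<forall>i<players p. \<forall>j<players p.
        arrives p i < departs p j \<and> departs p j < departs p i \<longrightarrow>
        V i (alloc p \<sigma> j) \<le> V i (alloc p \<sigma> i)))"

definition equitable :: "('s, 'z) procedure_scheme \<Rightarrow> bool" where
  "equitable p \<longleftrightarrow> (\<forall>V \<sigma>. honest_profile p V \<sigma> \<longrightarrow>
     (\<forall>i<players p. \<forall>j<players p. V i (alloc p \<sigma> i) = V j (alloc p \<sigma> j)))"

definition pareto_optimal :: "('s, 'z) procedure_scheme \<Rightarrow> bool" where
  "pareto_optimal p \<longleftrightarrow> (\<forall>V \<sigma>. honest_profile p V \<sigma> \<longrightarrow>
     \<not> (\<exists>B. divides cake (players p) B \<and>
          (\<exists>i<players p. V i (B ! i) > V i (alloc p \<sigma> i)) \<and>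
          (\<forall>j<players p. V j (B ! j) \<ge> V j (alloc p \<sigma> j))))"

definition weakly_pareto_optimal :: "('s, 'z) procedure_scheme \<Rightarrow> bool" where
  "weakly_pareto_optimal p \<longleftrightarrow> (\<forall>V \<sigma>. honest_profile p V \<sigma> \<longrightarrow>
     \<not> (\<exists>B. divides cake (players p) B \<and>
          (\<forall>i<players p. V i (B ! i) > V i (alloc p \<sigma> i))))"

text \<open>
  The least value that player i, with valuation v, can end up with when the
  players up to and including i follow \<sigma>, and the players still to come act
  truthfully on whatever valuations they hold.
\<close>

definition secured ::
    "('s, 'z) procedure_scheme \<Rightarrow> valuation \<Rightarrow> nat \<Rightarrow> (nat \<Rightarrow> 's) \<Rightarrow> real" where
  "secured p v i \<sigma> =
     (INF \<tau> \<in> {\<tau>. \<forall>j<players p.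
                   if arrives p j \<le> arrives p i then \<tau> j = \<sigma> j
                   else \<exists>w. is_valuation w \<and> honest p w (\<tau> j)}.
        v (alloc p \<tau> i))"

text \<open>
  Weak truthfulness compares what a risk averse player, ignorant of the valuations of the others,
  can be sure of. The comparison is made on arrival, for every situation created by the earlier
  players; it therefore also holds for the minimum over the valuations of all other players.
  Truthfulness compares the values obtained against given behaviour of the others.
\<close>

definition weakly_truthful :: "('s, 'z) procedure_scheme \<Rightarrow> bool" where
  "weakly_truthful p \<longleftrightarrow> (\<forall>V \<sigma>. honest_profile p V \<sigma> \<longrightarrow>
     (\<forall>i<players p. \<forall>s. legal p s \<longrightarrow>
        secured p (V i) i (\<sigma>(i := s)) \<le> secured p (V i) i \<sigma>))"

definition truthful :: "('s, 'z) procedure_scheme \<Rightarrow> bool" where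
  "truthful p \<longleftrightarrow> (\<forall>V \<sigma>. honest_profile p V \<sigma> \<longrightarrow>
     (\<forall>i<players p. \<forall>s. legal p s \<longrightarrow>
        V i (alloc p (\<sigma>(i := s)) i) \<le> V i (alloc p \<sigma> i)))"

text \<open>
  Slices have positive length; a single point is worthless to everybody.
\<close>

definition surjective :: "('s, 'z) procedure_scheme \<Rightarrow> bool" where
  "surjective p \<longleftrightarrow>
     (\<forall>S. divides cake (players p) S \<and> (\<forall>P\<in>set S. is_interval P \<and> interior P \<noteq> {}) \<longrightarrow>
        (\<exists>V \<sigma> \<pi>. honest_profile p V \<sigma> \<and> bij_betw \<pi> {..<players p} {..<players p} \<and>
           (\<forall>i<players p. alloc p \<sigma> i = S ! \<pi> i)))"

definition outcomes ::
    "('s, 'z) procedure_scheme \<Rightarrow> (nat \<Rightarrow> valuation) \<Rightarrow> real set list set" where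
  "outcomes p V = {map (alloc p \<sigma>) [0..<players p] | \<sigma>. honest_profile p V \<sigma>}"

definition scale_invariant :: "('s, 'z) procedure_scheme \<Rightarrow> bool" where
  "scale_invariant p \<longleftrightarrow> (\<forall>V. (\<forall>i<players p. is_valuation (V i)) \<longrightarrow>
     (\<forall>i<players p. \<forall>c>0. outcomes p (V(i := (\<lambda>P. c * V i P))) = outcomes p V))"

definition sequential :: "('s, 'z) procedure_scheme \<Rightarrow> bool" where
  "sequential p \<longleftrightarrow> (\<forall>V \<sigma>. honest_profile p V \<sigma> \<longrightarrow>
     (\<forall>i<players p. \<forall>j<players p. departs p i < departs p j \<longrightarrow>
        (\<forall>x\<in>alloc p \<sigma> i. \<forall>y\<in>alloc p \<sigma> j. x \<le> y)))"

text \<open>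
  The new order in which the player at position j is moved forward to position
  i < j: position k is now taken by the player formerly at
  advance j i k.
\<close>

definition advance :: "nat \<Rightarrow> nat \<Rightarrow> nat \<Rightarrow> nat" where
  "advance j i k = (if k = i then j else if i < k \<and> k \<le> j then k - 1 else k)"

definition order_monotonic :: "('s, 'z) procedure_scheme \<Rightarrow> bool" where
  "order_monotonic p \<longleftrightarrow> (\<forall>V \<sigma>. honest_profile p V \<sigma> \<longrightarrow>
     (\<forall>j<players p. \<forall>i<j.
        V j (alloc p \<sigma> j) \<le> V j (alloc p (\<sigma> \<circ> advance j i) i)))"

section \<open>Online mark-and-choose\<close>

text \<open>
  select s Ps is the index of the piece in Ps given to the preceding player;
  mark s m R marks the remaining cake R into m pieces.
\<close>

record strategy =
  select :: "real set list \<Rightarrow> nat"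
  mark :: "nat \<Rightarrow> real set \<Rightarrow> real set list"

definition legal_strategy :: "strategy \<Rightarrow> bool" where
  "legal_strategy s \<longleftrightarrow>
     (\<forall>Ps. Ps \<noteq> [] \<longrightarrow> select s Ps < length Ps) \<and>
     (\<forall>m R. 0 < m \<and> piece R \<longrightarrow> divides R m (mark s m R))"

definition honest_strategy :: "valuation \<Rightarrow> strategy \<Rightarrow> bool" where
  "honest_strategy v s \<longleftrightarrow> legal_strategy s \<and>
     (\<forall>Ps. Ps \<noteq> [] \<and> (\<forall>P\<in>set Ps. piece P) \<longrightarrow>
        (\<forall>P\<in>set Ps. v (Ps ! select s Ps) \<le> v P)) \<and>
     (\<forall>m R. 0 < m \<and> piece R \<longrightarrow>
        (\<forall>P\<in>set (mark s m R). \<forall>Q\<in>set (mark s m R). v P = v Q))"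

definition chosen :: "(nat \<Rightarrow> strategy) \<Rightarrow> nat \<Rightarrow> real set list \<Rightarrow> real set" where
  "chosen \<sigma> i Ps = Ps ! select (\<sigma> (Suc i)) Ps"

text \<open>
  The cake left when players 0, \<dots>, i - 1 have been served, which player i
  marks into n - i pieces, or takes if i is the last player.
\<close>

primrec remaining :: "nat \<Rightarrow> (nat \<Rightarrow> strategy) \<Rightarrow> nat \<Rightarrow> real set" where
  "remaining n \<sigma> 0 = cake"
| "remaining n \<sigma> (Suc i) =
     remaining n \<sigma> i - chosen \<sigma> i (mark (\<sigma> i) (n - i) (remaining n \<sigma> i))"

definition allocate :: "nat \<Rightarrow> (nat \<Rightarrow> strategy) \<Rightarrow> nat \<Rightarrow> real set" where
  "allocate n \<sigma> i =
     (if Suc i < n then chosen \<sigma> i (mark (\<sigma> i) (n - i) (remaining n \<sigma> i))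
      else remaining n \<sigma> i)"

text \<open>
  The order of events is: 0 arrives, 1 arrives, 0 departs, 2 arrives, 1 departs, and so on,
  until n - 1 arrives, n - 2 departs, n - 1 departs.
  (The subtraction is truncated for player 0.)
\<close>

definition mark_and_choose :: "nat \<Rightarrow> strategy procedure" where
  "mark_and_choose n =
     \<lparr> players = n,
       arrives = (\<lambda>i. 2 * i - 1),
       departs = (\<lambda>i. 2 * i + 2),
       legal = legal_strategy,
       honest = honest_strategy,
       alloc = allocate n \<rparr>"

end

theory Submission
  imports Defs
begin

text \<open>
  A truthful marker leaves only pieces of equal value, so player \<open>i\<close> obtains exactly the fraction
  \<open>1 / (n - i)\<close> of what remains when marking, and giving away a least valuable piece maximizes what
  remains. This yields forward proportionality and immediate envy freeness; it yields weak
  truthfulness because a successor who happens to have the same valuation holds any deviation down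
  to the average.

  The freedom in truthful behaviour (several equal divisions, ties among least valuable
  pieces) allows us to prescribe whole plays. This gives surjectivity, and two plays refute
  the remaining properties. In the first, all players but the last value the cake by length, and the
  last one values only the slice that the first player takes. In the second, the first player values
  the cake by length and all others value only the last slice, so that the second player receives
  nearly all that is worthless to the others. Here the first player could have
  marked that worthless part as a single piece, and the second player is worse off when moved to
  the front, obtaining \<open>1 / n\<close> instead of \<open>1 / (n - 1)\<close> of the total value.
\<close>

section \<open>Pieces, valuations and fair divisions\<close>

lemma piece_Union:
  assumes "finite \<P>" "\<And>P. P \<in> \<P> \<Longrightarrow> piece P"
  shows "piece (\<Union>\<P>)"
proof -
  obtain I where I: "\<And>P. P \<in> \<P> \<Longrightarrow> finite (I P) \<and> (\<forall>J\<in>I P. is_interval J) \<and> P = \<Union>(I P)"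
    using assms(2) unfolding piece_def by metis
  have "finite (\<Union>(I ` \<P>))" using I assms(1) by auto
  moreover have "\<forall>J\<in>\<Union>(I ` \<P>). is_interval J" using I by auto
  moreover have "\<Union>\<P> = \<Union>(\<Union>(I ` \<P>))"
  proof -
    have "(\<Union>P\<in>\<P>. P) = (\<Union>P\<in>\<P>. \<Union>(I P))"
      using I by (intro SUP_cong) auto
    then show ?thesis by (simp only: image_ident UN_UN_flatten SUP_UNION) (simp add: Union_eq, blast)
  qed
  moreover have "\<Union>\<P> \<subseteq> cake" using assms(2) unfolding piece_def by auto
  ultimately show ?thesis unfolding piece_def by metis
qed

lemma piece_interval: "is_interval J \<Longrightarrow> J \<subseteq> cake \<Longrightarrow> piece J"
  unfolding piece_def by (intro conjI exI[of _ "{J}"]) auto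

lemma piece_point: "0 \<le> a \<Longrightarrow> a \<le> 1 \<Longrightarrow> piece {a}"
  using piece_interval[of "{a..a}"] is_interval_cc[of a a] by simp

lemma piece_cake: "piece cake"
  by (simp add: piece_interval is_interval_cc)

lemma piece_empty: "piece {}"
  by (simp add: piece_interval)

lemma piece_Un: "piece P \<Longrightarrow> piece Q \<Longrightarrow> piece (P \<union> Q)"
  using piece_Union[of "{P, Q}"] by auto

lemma piece_Int_interval:
  assumes "piece P" "is_interval J"
  shows "piece (P \<inter> J)"
proof -
  obtain I where I: "finite I" "\<forall>K\<in>I. is_interval K" "P = \<Union>I" "P \<subseteq> cake"
    using assms(1) unfolding piece_def by auto
  have "piece (\<Union>((\<lambda>K. K \<inter> J) ` I))"
    using I assms(2) by (intro piece_Union) (auto intro!: piece_interval is_interval_Int)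
  moreover have "\<Union>((\<lambda>K. K \<inter> J) ` I) = P \<inter> J" using I by auto
  ultimately show ?thesis by simp
qed

text \<open>A point outside \<open>J\<close> lies below all of \<open>J\<close> or above all of it,
  and both of these sides are intervals.\<close>

lemma piece_Diff_interval:
  assumes "piece P" "is_interval J"
  shows "piece (P - J)"
proof -
  have 1: "is_interval {x. \<forall>y\<in>J. x < y}" "is_interval {x. \<forall>y\<in>J. y < x}"
    unfolding is_interval_1 by force+
  have "P - J = (P \<inter> {x. \<forall>y\<in>J. x < y}) \<union> (P \<inter> {x. \<forall>y\<in>J. y < x})"
  proof -
    have "(\<forall>y\<in>J. x < y) \<or> (\<forall>y\<in>J. y < x)" if "x \<notin> J" for x
      using that assms(2) unfolding is_interval_1 by (metis not_le)
    then show ?thesis by auto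
  qed
  then show ?thesis by (simp add: piece_Un piece_Int_interval assms(1) 1)
qed

lemma piece_Diff:
  assumes "piece P" "piece Q"
  shows "piece (P - Q)"
proof -
  obtain I where I: "finite I" "\<forall>K\<in>I. is_interval K" "Q = \<Union>I"
    using assms(2) unfolding piece_def by auto
  have "piece (P - \<Union>I)" using I(1,2)
  proof (induction I)
    case empty then show ?case using assms(1) by simp
  next
    case (insert J I)
    have "P - \<Union>(insert J I) = (P - \<Union>I) - J" by auto
    then show ?case using insert piece_Diff_interval by simp
  qed
  then show ?thesis using I by simp
qed

section \<open>Elementary properties of valuations\<close>

lemma valuation_nonneg: "is_valuation v \<Longrightarrow> piece P \<Longrightarrow> 0 \<le> v P"
  unfolding is_valuation_def by blast

lemma valuation_Un:
  "is_valuation v \<Longrightarrow> piece P \<Longrightarrow> piece Q \<Longrightarrow> P \<inter> Q = {} \<Longrightarrow> v (P \<union> Q) = v P + v Q"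
  unfolding is_valuation_def by blast

lemma valuation_empty: "is_valuation v \<Longrightarrow> v {} = 0"
  using valuation_Un[of v "{}" "{}"] piece_empty by simp

lemma valuation_Diff:
  assumes "is_valuation v" "piece P" "piece Q" "P \<subseteq> Q"
  shows "v (Q - P) = v Q - v P"
proof -
  have "v (P \<union> (Q - P)) = v P + v (Q - P)"
    using assms by (intro valuation_Un piece_Diff) auto
  moreover have "P \<union> (Q - P) = Q" using assms(4) by auto
  ultimately show ?thesis by simp
qed

lemma valuation_mono:
  assumes "is_valuation v" "piece P" "piece Q" "P \<subseteq> Q"
  shows "v P \<le> v Q"
  using valuation_Diff[OF assms] valuation_nonneg[OF assms(1) piece_Diff[OF assms(3,2)]] by simp

lemma valuation_UN:
  assumes "is_valuation v" "finite K" "\<And>k. k \<in> K \<Longrightarrow> piece (P k)" "disjoint_family_on P K"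
  shows "v (\<Union>k\<in>K. P k) = (\<Sum>k\<in>K. v (P k))"
  using assms(2-)
proof (induction K)
  case empty then show ?case using assms(1) by (simp add: valuation_empty)
next
  case (insert k K)
  have "v (P k \<union> (\<Union>k\<in>K. P k)) = v (P k) + v (\<Union>k\<in>K. P k)"
    using insert by (intro valuation_Un piece_Union assms(1)) (auto simp: disjoint_family_on_def)
  then show ?case using insert by (auto simp: disjoint_family_on_def)
qed

text \<open>
  Apply \<open>v {0} + v {a} \<le> v {0..a}\<close> and let \<open>a\<close> tend to 0.
\<close>

lemma valuation_zero_point:
  assumes "is_valuation v"
  shows "v {0..0} = 0"
proof -
  let ?D = "{(a, b). 0 \<le> a \<and> a \<le> b \<and> b \<le> (1::real)}"
  have c: "continuous_on ?D (\<lambda>(a, b). v {a..b})"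
    using assms unfolding is_valuation_def by blast
  have "continuous_on {0..1} (\<lambda>a. (\<lambda>(a, b). v {a..b}) (a, a))"
    by (rule continuous_on_compose2[OF c]) (auto intro!: continuous_intros)
  moreover have "continuous_on {0..1} (\<lambda>a. (\<lambda>(a, b). v {a..b}) (0, a))"
    by (rule continuous_on_compose2[OF c]) (auto intro!: continuous_intros)
  \<comment> \<open>Both limits are the value at the corner \<open>(0, 0)\<close> of the domain,
    approached once along the diagonal and once along the intervals that start at 0.\<close>
  ultimately have l: "((\<lambda>a. v {a..a}) \<longlongrightarrow> v {0..0}) (at 0 within {0..1})"
      "((\<lambda>a. v {0..a}) \<longlongrightarrow> v {0..0}) (at 0 within {0..1})"
    unfolding continuous_on_def by (auto dest!: bspec[of _ _ 0])
  have nt: "at (0::real) within {0..1} \<noteq> bot"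
    by (simp add: at_within_Icc_at_right)
  have ev: "\<forall>\<^sub>F a in at 0 within {0..1}. v {0..0} + v {a..a} \<le> v {0..a}"
  proof (rule eventually_at_topological[THEN iffD2], intro exI[of _ UNIV] conjI ballI impI)
    fix a :: real assume a: "a \<noteq> 0" "a \<in> {0..1}"
    then have "v ({0..0} \<union> {a..a}) \<le> v {0..a}"
      by (intro valuation_mono assms piece_Un) (auto simp: piece_point intro: piece_interval is_interval_cc)
    moreover have "v ({0..0} \<union> {a..a}) = v {0..0} + v {a..a}"
      using a by (intro valuation_Un assms) (auto simp: piece_point)
    ultimately show "v {0..0} + v {a..a} \<le> v {0..a}" by simp
  qed auto
  have "v {0..0} + v {0..0} \<le> v {0..0}"
    using tendsto_le[OF nt l(2) tendsto_add[OF tendsto_const l(1)] ev] .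
  moreover have "0 \<le> v {0..0}" by (intro valuation_nonneg assms) (auto simp: piece_point)
  ultimately show ?thesis by simp
qed

text \<open>Increments of \<open>v (R \<inter> {0..x})\<close> are bounded by those of
  \<open>v {0..x}\<close>, whose continuity is part of being a valuation.\<close>

lemma valuation_continuous_initial:
  assumes v: "is_valuation v" and R: "piece R"
  shows "continuous_on {0..1} (\<lambda>x. v (R \<inter> {0..x}))"
proof -
  have "continuous_on {(a, b). 0 \<le> a \<and> a \<le> b \<and> b \<le> 1} (\<lambda>(a, b). v {a..b})"
    using v unfolding is_valuation_def by blast
  then have "continuous_on {0..1} (\<lambda>a. (\<lambda>(a, b). v {a..b}) (0, a))"
    by (rule continuous_on_compose2) (auto intro!: continuous_intros)
  then have G: "continuous_on {0..1} (\<lambda>x. v {0..x})" by simp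
  have le: "0 \<le> v (R \<inter> {0..y}) - v (R \<inter> {0..x})"
      "v (R \<inter> {0..y}) - v (R \<inter> {0..x}) \<le> v {0..y} - v {0..x}"
    if "0 \<le> x" "x \<le> y" "y \<le> 1" for x y
  proof -
    have p: "piece {0..x}" "piece {0..y}" "piece (R \<inter> {0..x})" "piece (R \<inter> {0..y})"
      using that R by (auto intro!: piece_interval piece_Int_interval)
    have "v (R \<inter> {0..y} - R \<inter> {0..x}) = v (R \<inter> {0..y}) - v (R \<inter> {0..x})"
      "v ({0..y} - {0..x}) = v {0..y} - v {0..x}"
      using that p by (auto intro!: valuation_Diff[OF v])
    moreover have "v (R \<inter> {0..y} - R \<inter> {0..x}) \<le> v ({0..y} - {0..x})"
      using p by (intro valuation_mono[OF v] piece_Diff) auto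
    moreover have "v (R \<inter> {0..x}) \<le> v (R \<inter> {0..y})"
      using that p by (intro valuation_mono[OF v]) auto
    ultimately show "0 \<le> v (R \<inter> {0..y}) - v (R \<inter> {0..x})"
      "v (R \<inter> {0..y}) - v (R \<inter> {0..x}) \<le> v {0..y} - v {0..x}" by linarith+
  qed
  have dist: "dist (v (R \<inter> {0..y})) (v (R \<inter> {0..x})) \<le> dist (v {0..y}) (v {0..x})"
    if "x \<in> {0..1}" "y \<in> {0..1}" for x y
    using le[of x y] le[of y x] that by (cases "x \<le> y") (auto simp: dist_real_def)
  show ?thesis
    using G unfolding continuous_on_iff by (meson dist le_less_trans)
qed

section \<open>Values of the pieces in a division\<close>

lemma divides_sum:
  assumes "is_valuation v" "divides R m Ps"
  shows "v R = (\<Sum>i<m. v (Ps ! i))"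
proof -
  have "\<Union>(set Ps) = (\<Union>i<m. Ps ! i)"
    using assms(2) unfolding divides_def by (auto simp: set_conv_nth)
  then show ?thesis
    using assms valuation_UN[OF assms(1), of "{..<m}" "\<lambda>i. Ps ! i"] unfolding divides_def by auto
qed

lemma divides_equal_value:
  assumes "is_valuation v" "divides R m Ps" "\<forall>P\<in>set Ps. \<forall>Q\<in>set Ps. v P = v Q" "P \<in> set Ps"
  shows "v P = v R / m"
proof -
  have "v (Ps ! i) = v P" if "i < m" for i
    using assms(2-) that unfolding divides_def by (metis nth_mem)
  then have "v R = (\<Sum>i<m. v P)"
    unfolding divides_sum[OF assms(1,2)] by (intro sum.cong) auto
  moreover have "m \<noteq> 0" using assms(2,4) by (auto simp: divides_def)
  ultimately show ?thesis by simp
qed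

lemma divides_least_value:
  assumes "is_valuation v" "divides R m Ps" "\<forall>P\<in>set Ps. x \<le> v P" "0 < m"
  shows "x \<le> v R / m"
proof -
  have "(\<Sum>i<m. x) \<le> v R"
    unfolding divides_sum[OF assms(1,2)]
    using assms(2,3) by (intro sum_mono) (auto simp: divides_def)
  then show ?thesis using assms(4) by (simp add: field_simps)
qed

lemma divides_Cons:
  assumes "piece P" "divides R m Ps" "P \<inter> R = {}"
  shows "divides (P \<union> R) (Suc m) (P # Ps)"
proof -
  have "disjoint_family_on (\<lambda>i. (P # Ps) ! i) {..<Suc m}"
    unfolding disjoint_family_on_def
  proof (intro ballI impI)
    fix i j assume "i \<in> {..<Suc m}" "j \<in> {..<Suc m}" "i \<noteq> j"
    moreover have "P \<inter> Ps ! k = {}" if "k < m" for k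
      using assms that unfolding divides_def by (metis Int_Union nth_mem UN_I Union_disjoint inf_commute)
    ultimately show "(P # Ps) ! i \<inter> (P # Ps) ! j = {}"
      using assms(2) unfolding divides_def disjoint_family_on_def
      by (cases i; cases j) (auto simp: Int_commute)
  qed
  then show ?thesis using assms unfolding divides_def by auto
qed

text \<open>For plays in which successive players keep to one fixed division: the tail of the list
  is again a division, which player \<open>i\<close> may mark.\<close>

lemma divides_drop:
  assumes "divides R m Ps" "i \<le> m"
  shows "divides (\<Union>(set (drop i Ps))) (m - i) (drop i Ps)"
proof -
  have "disjoint_family_on (\<lambda>k. drop i Ps ! k) {..<m - i}"
    unfolding disjoint_family_on_def
  proof (intro ballI impI)
    fix k l assume "k \<in> {..<m - i}" "l \<in> {..<m - i}" "k \<noteq> l"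
    then show "drop i Ps ! k \<inter> drop i Ps ! l = {}"
      using assms unfolding divides_def disjoint_family_on_def by simp
  qed
  then show ?thesis
    using assms set_drop_subset[of i Ps] unfolding divides_def by (auto simp del: nth_drop)
qed

lemma divides_Union_drop_Suc:
  assumes "divides R m Ps" "i < m"
  shows "\<Union>(set (drop (Suc i) Ps)) = \<Union>(set (drop i Ps)) - Ps ! i"
proof -
  have l: "length Ps = m" using assms unfolding divides_def by simp
  have d: "Ps ! i \<inter> Ps ! j = {}" if "j < m" "i \<noteq> j" for j
    using assms that unfolding divides_def disjoint_family_on_def by auto
  have "Ps ! i \<inter> \<Union>(set (drop (Suc i) Ps)) = {}"
  proof -
    have "Ps ! i \<inter> P = {}" if P: "P \<in> set (drop (Suc i) Ps)" for P
    proof -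
      obtain k where k: "k < m - Suc i" "P = drop (Suc i) Ps ! k"
        using P l by (auto simp: in_set_conv_nth)
      then have "P = Ps ! (Suc i + k)" using l assms(2) by (simp add: nth_drop)
      then show ?thesis using d[of "Suc i + k"] k by auto
    qed
    then show ?thesis by blast
  qed
  moreover have "drop i Ps = Ps ! i # drop (Suc i) Ps"
    using assms l by (simp add: Cons_nth_drop_Suc)
  ultimately show ?thesis by auto
qed

text \<open>Removing one average share out of \<open>m + 1\<close> leaves the average of the others
  unchanged. This serves both the construction of equal divisions and the bound on a chooser's
  share.\<close>

lemma proportional_remainder:
  fixes m x :: real
  assumes "0 < m"
  shows "(x - x / (m + 1)) / m = x / (m + 1)"
proof -
  have "x - x / (m + 1) = x * m / (m + 1)" using assms by (simp add: divide_simps) algebra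
  then show ?thesis using assms by simp
qed

text \<open>Pieces are cut off from the left: the intermediate value theorem yields an initial part
  of the right value, and the induction hypothesis divides the rest.\<close>

lemma fair_division_exists:
  assumes v: "is_valuation v" and "piece R" "0 < m"
  shows "\<exists>Ps. divides R m Ps \<and> (\<forall>P\<in>set Ps. v P = v R / m)"
  using assms(2,3)
proof (induction m arbitrary: R)
  case (Suc m)
  show ?case
  proof (cases "m = 0")
    case True
    have "divides R (Suc m) [R]"
      using Suc.prems True by (auto simp: divides_def disjoint_family_on_def)
    then show ?thesis using True by (intro exI[of _ "[R]"]) auto
  next
    case False
    let ?F = "\<lambda>x. v (R \<inter> {0..x})"
    have "piece (R \<inter> {0..0})" "piece {0..0}"
      using Suc.prems(1) piece_point[of 0] piece_Int_interval[OF _ is_interval_cc[of 0 0]] by simp_all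
    then have "?F 0 \<le> v {0..0}" by (intro valuation_mono[OF v]) auto
    \<comment> \<open>The point 0 may belong to \<open>R\<close>; its worthlessness puts the left
      end of the intermediate value argument at or below the target.\<close>
    then have F0: "?F 0 \<le> 0" using valuation_zero_point[OF v] by simp
    have R1: "R \<inter> {0..1} = R" using Suc.prems unfolding piece_def by auto
    have nn: "0 \<le> v R" using valuation_nonneg[OF v] Suc.prems by blast
    have "?F 0 \<le> v R / Suc m" using F0 nn by (meson order_trans divide_nonneg_nonneg of_nat_0_le_iff)
    moreover have "v R / Suc m \<le> ?F 1" using nn R1 by (simp add: field_simps)
    ultimately obtain x where x: "0 \<le> x" "x \<le> 1" "?F x = v R / Suc m"
      using IVT'[of ?F 0 "v R / Suc m" 1] valuation_continuous_initial[OF v] Suc.prems by auto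
    let ?P = "R \<inter> {0..x}" and ?Q = "R - (R \<inter> {0..x})"
    have p: "piece ?P" "piece ?Q" using Suc.prems by (auto intro!: piece_Int_interval piece_Diff)
    have vQ: "v ?Q = v R - v R / Suc m"
      using valuation_Diff[OF v p(1)] Suc.prems x by simp
    have "v ?Q / m = v R / Suc m"
      using vQ proportional_remainder[of "real m" "v R"] False by (simp add: add.commute)
    then obtain Ps where Ps: "divides ?Q m Ps" "\<forall>P\<in>set Ps. v P = v R / Suc m"
      using Suc.IH[OF p(2)] False by auto
    have "divides (?P \<union> ?Q) (Suc m) (?P # Ps)"
      using Ps p by (intro divides_Cons) auto
    moreover have "?P \<union> ?Q = R" by auto
    ultimately show ?thesis using Ps x by (intro exI[of _ "?P # Ps"]) auto
  qed
qed simp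

section \<open>Honest play\<close>

lemma honest_legal: "honest_strategy v s \<Longrightarrow> legal_strategy s"
  unfolding honest_strategy_def by simp

lemma honest_strategyI:
  assumes "legal_strategy s"
    and "\<And>Ps P. Ps \<noteq> [] \<Longrightarrow> \<forall>P\<in>set Ps. piece P \<Longrightarrow> P \<in> set Ps \<Longrightarrow> v (Ps ! select s Ps) \<le> v P"
    and "\<And>m R P Q. 0 < m \<Longrightarrow> piece R \<Longrightarrow> P \<in> set (mark s m R) \<Longrightarrow> Q \<in> set (mark s m R) \<Longrightarrow> v P = v Q"
  shows "honest_strategy v s"
  using assms unfolding honest_strategy_def by blast

lemma honest_mark:
  "honest_strategy v s \<Longrightarrow> 0 < m \<Longrightarrow> piece R \<Longrightarrow> P \<in> set (mark s m R) \<Longrightarrow> Q \<in> set (mark s m R) \<Longrightarrow>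
    v P = v Q"
  unfolding honest_strategy_def by blast

lemma honest_select:
  "honest_strategy v s \<Longrightarrow> \<forall>P\<in>set Ps. piece P \<Longrightarrow> P \<in> set Ps \<Longrightarrow> v (Ps ! select s Ps) \<le> v P"
  unfolding honest_strategy_def by (metis empty_iff list.set(1))

text \<open>Provides the default behaviour that prescribed plays overwrite at a few inputs, and the
  successors that form the worst case for a deviation.\<close>

lemma honest_strategy_exists:
  assumes "is_valuation v"
  obtains s where "honest_strategy v s"
proof -
  obtain D where D: "\<And>m R. 0 < m \<and> piece R \<Longrightarrow> divides R m (D m R) \<and> (\<forall>P\<in>set (D m R). v P = v R / m)"
  proof -
    have "\<forall>m R. \<exists>Ps. 0 < m \<and> piece R \<longrightarrow> divides R m Ps \<and> (\<forall>P\<in>set Ps. v P = v R / m)"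
      using fair_division_exists[OF assms] by blast
    then show thesis using that by metis
  qed
  define c where "c = (\<lambda>Ps. SOME i. i < length Ps \<and> (\<forall>P\<in>set Ps. v (Ps ! i) \<le> v P))"
  have c: "c Ps < length Ps \<and> (\<forall>P\<in>set Ps. v (Ps ! c Ps) \<le> v P)" if "Ps \<noteq> []" for Ps
  proof -
    have "Min (v ` set Ps) \<in> v ` set Ps" using that by (intro Min_in) auto
    then obtain i where "i < length Ps" "v (Ps ! i) = Min (v ` set Ps)"
      by (auto simp: in_set_conv_nth)
    then have "i < length Ps \<and> (\<forall>P\<in>set Ps. v (Ps ! i) \<le> v P)" by simp
    then show ?thesis unfolding c_def by (rule someI)
  qed
  have "honest_strategy v \<lparr>select = c, mark = D\<rparr>"
  proof (rule honest_strategyI)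
    show "legal_strategy \<lparr>select = c, mark = D\<rparr>"
      unfolding legal_strategy_def using c D by simp
    show "v P = v Q" if "0 < m" "piece R" "P \<in> set (mark \<lparr>select = c, mark = D\<rparr> m R)"
        "Q \<in> set (mark \<lparr>select = c, mark = D\<rparr> m R)" for m R P Q
      using D[of m R] that by (metis strategy.select_convs(2))
  qed (use c in simp)
  then show thesis by (rule that)
qed

lemma legal_mark_update:
  assumes "legal_strategy s" "divides R m D"
  shows "legal_strategy (s\<lparr>mark := (mark s)(m := (mark s m)(R := D))\<rparr>)"
  using assms unfolding legal_strategy_def by simp

text \<open>Honesty constrains each input of \<open>mark\<close> separately, so any equal division
  may be substituted at a single pair \<open>m\<close>, \<open>R\<close>.\<close>

lemma honest_mark_update:
  assumes "honest_strategy v s" "divides R m D" "\<forall>P\<in>set D. \<forall>Q\<in>set D. v P = v Q"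
  shows "honest_strategy v (s\<lparr>mark := (mark s)(m := (mark s m)(R := D))\<rparr>)"
    (is "honest_strategy v ?s")
proof (rule honest_strategyI)
  show "legal_strategy ?s" by (rule legal_mark_update[OF honest_legal[OF assms(1)] assms(2)])
  show "v (Ps ! select ?s Ps) \<le> v P" if "\<forall>P\<in>set Ps. piece P" "P \<in> set Ps" for Ps P
    using honest_select[OF assms(1)] that by simp
  show "v P = v P'" if "0 < k" "piece Q" "P \<in> set (mark ?s k Q)" "P' \<in> set (mark ?s k Q)" for k Q P P'
  proof (cases "k = m \<and> Q = R")
    case True
    then have "P \<in> set D" "P' \<in> set D" using that by simp_all
    then show ?thesis using assms(3) by blast
  next
    case False
    then have "mark ?s k Q = mark s k Q" by auto
    then show ?thesis using honest_mark[OF assms(1)] that by metis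
  qed
qed

lemma honest_select_update:
  assumes "honest_strategy v s" "c < length D" "\<forall>P\<in>set D. v (D ! c) \<le> v P"
  shows "honest_strategy v (s\<lparr>select := (select s)(D := c)\<rparr>)" (is "honest_strategy v ?s")
proof (rule honest_strategyI)
  show "legal_strategy ?s"
    using honest_legal[OF assms(1)] assms(2) unfolding legal_strategy_def by simp
  show "v (Ps ! select ?s Ps) \<le> v P" if "\<forall>P\<in>set Ps. piece P" "P \<in> set Ps" for Ps P
    using honest_select[OF assms(1) that] that assms(3) by (cases "Ps = D") simp_all
  show "v P = v P'" if "0 < k" "piece Q" "P \<in> set (mark ?s k Q)" "P' \<in> set (mark ?s k Q)" for k Q P P'
    using that by (intro honest_mark[OF assms(1) that(1,2)]) simp_all
qed

section \<open>Values along a legal play\<close>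

lemma legal_mark: "legal_strategy s \<Longrightarrow> 0 < m \<Longrightarrow> piece R \<Longrightarrow> divides R m (mark s m R)"
  unfolding legal_strategy_def by blast

lemma legal_select: "legal_strategy s \<Longrightarrow> Ps \<noteq> [] \<Longrightarrow> select s Ps < length Ps"
  unfolding legal_strategy_def by blast

lemma remaining_piece:
  assumes "\<forall>i<n. legal_strategy (\<sigma> i)" "i < n"
  shows "piece (remaining n \<sigma> i)"
  using assms(2)
proof (induction i)
  case (Suc i)
  let ?D = "mark (\<sigma> i) (n - i) (remaining n \<sigma> i)"
  have d: "divides (remaining n \<sigma> i) (n - i) ?D"
    using Suc assms(1) by (intro legal_mark) auto
  then have "?D \<noteq> []" "length ?D = n - i" using Suc.prems unfolding divides_def by auto
  then have "chosen \<sigma> i ?D \<in> set ?D"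
    using legal_select[of "\<sigma> (Suc i)" ?D] assms(1) Suc.prems unfolding chosen_def by simp
  then have "piece (chosen \<sigma> i ?D)" using d unfolding divides_def by auto
  then show ?case using Suc by (simp add: piece_Diff)
qed (simp add: piece_cake)

lemma marked_divides:
  assumes "\<forall>i<n. legal_strategy (\<sigma> i)" "Suc i < n"
  shows "divides (remaining n \<sigma> i) (n - i) (mark (\<sigma> i) (n - i) (remaining n \<sigma> i))"
  using assms by (intro legal_mark remaining_piece) auto

lemma allocate_in_marked:
  assumes "\<forall>i<n. legal_strategy (\<sigma> i)" "Suc i < n"
  shows "allocate n \<sigma> i \<in> set (mark (\<sigma> i) (n - i) (remaining n \<sigma> i))"
proof -
  let ?D = "mark (\<sigma> i) (n - i) (remaining n \<sigma> i)"
  have "?D \<noteq> []" using marked_divides[OF assms] assms(2) unfolding divides_def by auto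
  then show ?thesis
    using legal_select[of "\<sigma> (Suc i)" ?D] assms unfolding allocate_def chosen_def by simp
qed

lemma allocate_piece:
  assumes "\<forall>i<n. legal_strategy (\<sigma> i)" "i < n"
  shows "piece (allocate n \<sigma> i)"
proof (cases "Suc i < n")
  case True
  then show ?thesis using allocate_in_marked[OF assms(1)] marked_divides[OF assms(1)]
    unfolding divides_def by blast
next
  case False
  then show ?thesis using remaining_piece[OF assms] by (simp add: allocate_def)
qed

lemma allocate_subset_remaining:
  assumes "\<forall>i<n. legal_strategy (\<sigma> i)" "i < n"
  shows "allocate n \<sigma> i \<subseteq> remaining n \<sigma> i"
proof (cases "Suc i < n")
  case True
  then show ?thesis using allocate_in_marked[OF assms(1)] marked_divides[OF assms(1)]
    unfolding divides_def by blast
qed (simp add: allocate_def)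

lemma remaining_Suc: "Suc i < n \<Longrightarrow> remaining n \<sigma> (Suc i) = remaining n \<sigma> i - allocate n \<sigma> i"
  by (simp add: allocate_def)

lemma remaining_eq_cake_Diff:
  "i < n \<Longrightarrow> remaining n \<sigma> i = cake - (\<Union>j<i. allocate n \<sigma> j)"
  by (induction i) (auto simp: remaining_Suc lessThan_Suc simp del: remaining.simps(2))

lemma value_remaining_Suc:
  assumes "is_valuation v" "\<forall>i<n. legal_strategy (\<sigma> i)" "Suc i < n"
  shows "v (remaining n \<sigma> (Suc i)) = v (remaining n \<sigma> i) - v (allocate n \<sigma> i)"
  unfolding remaining_Suc[OF assms(3)] using assms
  by (intro valuation_Diff allocate_piece remaining_piece allocate_subset_remaining) auto

text \<open>All marked pieces are worth the average, so it does not matter which one the successor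
  selects. The last player fits in with \<open>n - i = 1\<close>.\<close>

lemma honest_marker_value:
  assumes "is_valuation v" "\<forall>i<n. legal_strategy (\<sigma> i)" "honest_strategy v (\<sigma> i)" "i < n"
  shows "v (allocate n \<sigma> i) = v (remaining n \<sigma> i) / real (n - i)"
proof (cases "Suc i < n")
  case True
  then have "\<forall>P\<in>set (mark (\<sigma> i) (n - i) (remaining n \<sigma> i)).
      \<forall>Q\<in>set (mark (\<sigma> i) (n - i) (remaining n \<sigma> i)). v P = v Q"
    using honest_mark[OF assms(3)] remaining_piece[OF assms(2,4)] assms(4) by (meson zero_less_diff)
  then show ?thesis
    using True
    by (intro divides_equal_value[OF assms(1) marked_divides] allocate_in_marked assms(2))
next
  case False
  then have "n - i = 1" using assms(4) by simp
  then show ?thesis using False by (simp add: allocate_def)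
qed

lemma honest_chooser_least:
  assumes "\<forall>i<n. legal_strategy (\<sigma> i)" "honest_strategy v (\<sigma> (Suc i))" "Suc i < n"
    "P \<in> set (mark (\<sigma> i) (n - i) (remaining n \<sigma> i))"
  shows "v (allocate n \<sigma> i) \<le> v P"
proof -
  have "\<forall>P\<in>set (mark (\<sigma> i) (n - i) (remaining n \<sigma> i)). piece P"
    using marked_divides[OF assms(1,3)] unfolding divides_def by blast
  then show ?thesis
    using honest_select[OF assms(2) _ assms(4)] assms(3) unfolding allocate_def chosen_def by simp
qed

lemma honest_chooser_value:
  assumes "is_valuation v" "\<forall>i<n. legal_strategy (\<sigma> i)" "Suc i < n"
    "honest_strategy v (\<sigma> (Suc i))"
  shows "v (allocate n \<sigma> i) \<le> v (remaining n \<sigma> i) / real (n - i)"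
  using assms honest_chooser_least[OF assms(2,4,3)]
  by (intro divides_least_value[OF assms(1) marked_divides]) auto

text \<open>The chooser gives away at most an average piece, so the average over the remaining
  \<open>n - Suc i\<close> shares does not fall; the chooser then obtains exactly this average, as
  marker or as last player.\<close>

lemma honest_share:
  assumes "is_valuation v" "\<forall>i<n. legal_strategy (\<sigma> i)" "Suc i < n"
    "honest_strategy v (\<sigma> (Suc i))"
  shows "v (remaining n \<sigma> i) / real (n - i) \<le> v (allocate n \<sigma> (Suc i))"
proof -
  let ?x = "v (remaining n \<sigma> i)" and ?m = "real (n - Suc i)"
  have m: "real (n - i) = ?m + 1" "0 < ?m" using assms(3) by linarith+
  have "v (allocate n \<sigma> (Suc i)) = (?x - v (allocate n \<sigma> i)) / ?m"
    using honest_marker_value[OF assms(1,2,4,3)] value_remaining_Suc[OF assms(1-3)] by simp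
  also have "\<dots> \<ge> (?x - ?x / (?m + 1)) / ?m"
    using honest_chooser_value[OF assms] m by (simp add: divide_right_mono)
  also have "(?x - ?x / (?m + 1)) / ?m = ?x / (?m + 1)"
    by (rule proportional_remainder[OF m(2)])
  finally show ?thesis using m by simp
qed

section \<open>Forward proportionality, immediate envy freeness and weak truthfulness\<close>

lemma mark_and_choose_simps [simp]:
  "players (mark_and_choose n) = n"
  "arrives (mark_and_choose n) i = 2 * i - 1"
  "departs (mark_and_choose n) i = 2 * i + 2"
  "legal (mark_and_choose n) = legal_strategy"
  "honest (mark_and_choose n) = honest_strategy"
  "alloc (mark_and_choose n) = allocate n"
  by (simp_all add: mark_and_choose_def)

lemma honest_profile_legal:
  "honest_profile (mark_and_choose n) V \<sigma> \<Longrightarrow> \<forall>i<n. legal_strategy (\<sigma> i)"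
  unfolding honest_profile_def by (auto intro: honest_legal)

text \<open>Player \<open>i - 1\<close> is still present when player \<open>i\<close> arrives, so
  only those before \<open>i - 1\<close> have left. Truncated subtraction covers player 0.\<close>

lemma left_before_mark_and_choose:
  "i < n \<Longrightarrow> left_before (mark_and_choose n) i = {..<i - 1}"
  by (auto simp: left_before_def)

lemma forward_proportional_mark_and_choose: "forward_proportional (mark_and_choose n)"
  unfolding forward_proportional_def Let_def mark_and_choose_simps
proof (intro allI impI)
  fix V \<sigma> i assume h: "honest_profile (mark_and_choose n) V \<sigma>" and i: "i < n"
  let ?L = "left_before (mark_and_choose n) i"
  have v: "is_valuation (V i)" and hi: "honest_strategy (V i) (\<sigma> i)" and pos: "V i cake \<noteq> 0"
    using h i unfolding honest_profile_def is_valuation_def by auto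
  \<comment> \<open>The cake left on the arrival of player \<open>i\<close> is the one marked by
    player \<open>i - 1\<close>; for player 0 truncation turns it into the whole cake, marked by
    player 0.\<close>
  have "V i (remaining n \<sigma> (i - 1)) / real (n - (i - 1)) \<le> V i (allocate n \<sigma> i)"
  proof (cases i)
    case 0
    then show ?thesis using honest_marker_value[OF v honest_profile_legal[OF h] hi i] by simp
  next
    case (Suc j)
    then show ?thesis using honest_share[OF v honest_profile_legal[OF h], of j] hi i by simp
  qed
  then show "V i (cake - (\<Union>j\<in>?L. allocate n \<sigma> j)) / V i cake / (real n - real (card ?L)) * V i cake
      \<le> V i (allocate n \<sigma> i)"
    using i pos by (simp add: left_before_mark_and_choose remaining_eq_cake_Diff of_nat_diff)
qed

lemma immediately_envy_free_mark_and_choose: "immediately_envy_free (mark_and_choose n)"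
  unfolding immediately_envy_free_def mark_and_choose_simps
proof (intro allI impI)
  fix V \<sigma> i j assume h: "honest_profile (mark_and_choose n) V \<sigma>" and i: "i < n" "j < n"
    "2 * i - 1 < 2 * j + 2 \<and> 2 * j + 2 < 2 * i + 2"
  \<comment> \<open>The only departure between the arrival and the departure of a player is that of
    the immediate predecessor.\<close>
  then have ij: "i = Suc j" by linarith
  have "is_valuation (V i)" "honest_strategy (V i) (\<sigma> (Suc j))"
    using h i(1) ij unfolding honest_profile_def by auto
  then show "V i (allocate n \<sigma> j) \<le> V i (allocate n \<sigma> i)"
    using honest_chooser_value[of "V i" n \<sigma> j] honest_share[of "V i" n \<sigma> j]
      honest_profile_legal[OF h] i(1) ij by simp
qed

text \<open>Index \<open>i\<close> is included because player \<open>i\<close> selects the piece of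
  player \<open>i - 1\<close> and thereby determines what is left.\<close>

lemma remaining_cong:
  "(\<And>j. j \<le> i \<Longrightarrow> \<sigma> j = \<tau> j) \<Longrightarrow> remaining n \<sigma> i = remaining n \<tau> i"
  by (induction i) (auto simp: chosen_def)

text \<open>A deviation of player \<open>i\<close> leaves the predecessor's marking untouched, so it
  acts on this remainder only through the selection, and an honest selection gives away a least
  valuable piece.\<close>

lemma remaining_honest_max:
  assumes "is_valuation v" "\<forall>i<n. legal_strategy (\<sigma> i)" "honest_strategy v (\<sigma> i)"
    "legal_strategy s" "i < n"
  shows "v (remaining n (\<sigma>(i := s)) i) \<le> v (remaining n \<sigma> i)"
proof (cases i)
  case (Suc k)
  let ?\<sigma> = "\<sigma>(i := s)"
  have l: "\<forall>i<n. legal_strategy (?\<sigma> i)" using assms by simp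
  have k: "Suc k < n" "honest_strategy v (\<sigma> (Suc k))" using Suc assms by auto
  have r: "remaining n ?\<sigma> k = remaining n \<sigma> k" using Suc by (intro remaining_cong) auto
  have \<sigma>k: "?\<sigma> k = \<sigma> k" using Suc by simp
  have "allocate n ?\<sigma> k \<in> set (mark (\<sigma> k) (n - k) (remaining n \<sigma> k))"
    using allocate_in_marked[OF l k(1)] unfolding r \<sigma>k .
  then have "v (allocate n \<sigma> k) \<le> v (allocate n ?\<sigma> k)"
    using honest_chooser_least[OF assms(2) k(2,1)] by simp
  then have "v (remaining n ?\<sigma> (Suc k)) \<le> v (remaining n \<sigma> (Suc k))"
    unfolding value_remaining_Suc[OF assms(1) l k(1)] value_remaining_Suc[OF assms(1,2) k(1)] r by linarith
  then show ?thesis unfolding Suc .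
qed simp

text \<open>Both guarantees are compared with \<open>B\<close>, an equal share of what remains after
  the honest selection. Honest play attains \<open>B\<close> against all successors; a deviation
  cannot raise the value of the remainder, and a successor with the same valuation concedes at most
  the average of it.\<close>

lemma weakly_truthful_mark_and_choose: "weakly_truthful (mark_and_choose n)"
  unfolding weakly_truthful_def mark_and_choose_simps
proof (intro allI impI)
  fix V \<sigma> i s
  assume h: "honest_profile (mark_and_choose n) V \<sigma>" and i: "i < n" and s: "legal_strategy s"
  let ?\<sigma> = "\<sigma>(i := s)"
  define T where "T = (\<lambda>\<rho>. {\<tau>. \<forall>j<n. if j \<le> i then \<tau> j = \<rho> j
      else \<exists>w. is_valuation w \<and> honest_strategy w (\<tau> j)})"
  \<comment> \<open>The arrival times 0, 1, 3, 5 and so on are strictly increasing despite the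
    truncation at 0.\<close>
  have "2 * j - 1 \<le> 2 * i - 1 \<longleftrightarrow> j \<le> i" for j by linarith
  then have secured: "secured (mark_and_choose n) (V i) i \<rho> = (INF \<tau>\<in>T \<rho>. V i (allocate n \<tau> i))" for \<rho>
    unfolding secured_def T_def by simp
  have v: "is_valuation (V i)" and hi: "honest_strategy (V i) (\<sigma> i)"
    and l: "\<forall>i<n. legal_strategy (\<sigma> i)"
    using h i honest_profile_legal[OF h] unfolding honest_profile_def by auto
  have l': "\<forall>i<n. legal_strategy (?\<sigma> i)" using l s by simp
  have T_legal: "\<forall>j<n. legal_strategy (\<tau> j)" if "\<tau> \<in> T \<rho>" "\<forall>j<n. legal_strategy (\<rho> j)" for \<tau> \<rho>
  proof (intro allI impI)
    fix j assume "j < n"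
    then have "if j \<le> i then \<tau> j = \<rho> j else \<exists>w. is_valuation w \<and> honest_strategy w (\<tau> j)"
      using that(1) unfolding T_def by blast
    then show "legal_strategy (\<tau> j)"
      using that(2) \<open>j < n\<close> by (auto split: if_splits intro: honest_legal)
  qed
  have T_eq: "\<tau> j = \<rho> j" if "\<tau> \<in> T \<rho>" "j \<le> i" for \<tau> \<rho> j
    using that i unfolding T_def by auto
  \<comment> \<open>The worst case for a deviation: all later players hold the valuation of player \<open>i\<close>.\<close>
  obtain u where u: "honest_strategy (V i) u" by (rule honest_strategy_exists[OF v])
  define \<tau> where "\<tau> = (\<lambda>\<rho> j. if j \<le> i then \<rho> j else u)"
  have \<tau>T: "\<tau> \<rho> \<in> T \<rho>" for \<rho>
    using u v unfolding \<tau>_def T_def by auto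
  define B where "B = V i (remaining n \<sigma> i) / real (n - i)"
  have "B \<le> V i (allocate n \<tau>' i)" if "\<tau>' \<in> T \<sigma>" for \<tau>'
  proof -
    have "remaining n \<tau>' i = remaining n \<sigma> i" by (intro remaining_cong T_eq that)
    then show ?thesis
      using honest_marker_value[OF v T_legal[OF that l] _ i] hi T_eq[OF that] unfolding B_def by simp
  qed
  then have 1: "B \<le> (INF \<tau>\<in>T \<sigma>. V i (allocate n \<tau> i))"
    using \<tau>T by (intro cINF_greatest) auto
  have t: "\<forall>j<n. legal_strategy (\<tau> ?\<sigma> j)" by (rule T_legal[OF \<tau>T l'])
  \<comment> \<open>Nonnegativity of values supplies the lower bound without which an infimum of
    reals need not lie below the elements.\<close>
  have "(INF \<tau>\<in>T ?\<sigma>. V i (allocate n \<tau> i)) \<le> V i (allocate n (\<tau> ?\<sigma>) i)"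
  proof (rule cINF_lower[OF bdd_belowI2])
    show "0 \<le> V i (allocate n \<tau> i)" if "\<tau> \<in> T ?\<sigma>" for \<tau>
      by (rule valuation_nonneg[OF v allocate_piece[OF T_legal[OF that l'] i]])
  qed (rule \<tau>T)
  also have "\<dots> \<le> V i (remaining n (\<tau> ?\<sigma>) i) / real (n - i)"
  proof (cases "Suc i < n")
    case True
    then show ?thesis using u by (intro honest_chooser_value v t) (auto simp: \<tau>_def)
  next
    case False
    then have "n - i = 1" using i by simp
    then show ?thesis using False by (simp add: allocate_def)
  qed
  also have "remaining n (\<tau> ?\<sigma>) i = remaining n ?\<sigma> i"
    by (intro remaining_cong) (simp add: \<tau>_def)
  also have "V i (remaining n ?\<sigma> i) / real (n - i) \<le> B"
    unfolding B_def by (intro divide_right_mono remaining_honest_max v l hi s i) simp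
  finally show "secured (mark_and_choose n) (V i) i ?\<sigma> \<le> secured (mark_and_choose n) (V i) i \<sigma>"
    unfolding secured using 1 by linarith
qed

section \<open>Profiles with a prescribed allocation\<close>

text \<open>Arbitrary honest strategies are overwritten at no more than two inputs each: the list to
  select from and the cake to mark. Selecting index 0 throughout is harmless, as the order of the
  marked pieces is free.\<close>

lemma honest_profile_realizing:
  fixes V :: "nat \<Rightarrow> valuation" and R :: "nat \<Rightarrow> real set" and D :: "nat \<Rightarrow> real set list"
  assumes V: "\<And>i. i < n \<Longrightarrow> is_valuation (V i)"
    and D: "\<And>i. Suc i < n \<Longrightarrow> divides (R i) (n - i) (D i)"
    and R0: "R 0 = cake" and RS: "\<And>i. Suc i < n \<Longrightarrow> R (Suc i) = R i - D i ! 0"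
    and eq: "\<And>i. Suc i < n \<Longrightarrow> \<forall>P\<in>set (D i). \<forall>Q\<in>set (D i). V i P = V i Q"
    and least: "\<And>i. Suc i < n \<Longrightarrow> \<forall>P\<in>set (D i). V (Suc i) (D i ! 0) \<le> V (Suc i) P"
  obtains \<sigma> where "honest_profile (mark_and_choose n) V \<sigma>"
    "\<And>i. Suc i < n \<Longrightarrow> allocate n \<sigma> i = D i ! 0" "\<And>i. i < n \<Longrightarrow> remaining n \<sigma> i = R i"
proof -
  have "\<exists>s. honest_strategy (V i) s \<and> (Suc i < n \<longrightarrow> mark s (n - i) (R i) = D i) \<and>
      (\<forall>k. i = Suc k \<longrightarrow> select s (D k) = 0)" if i: "i < n" for i
  proof -
    obtain s where s: "honest_strategy (V i) s" by (rule honest_strategy_exists[OF V[OF i]])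
    obtain t where t: "honest_strategy (V i) t" "Suc i < n \<longrightarrow> mark t (n - i) (R i) = D i"
    proof (cases "Suc i < n")
      case True
      show thesis
        by (rule that[OF honest_mark_update[OF s D[OF True] eq[OF True]]]) simp
    next
      case False
      then show thesis using that[OF s] by simp
    qed
    show ?thesis
    proof (cases i)
      case 0
      then show ?thesis using t by auto
    next
      case (Suc k)
      then have k: "Suc k < n" using i by simp
      have "0 < length (D k)" using D[OF k] k unfolding divides_def by simp
      then have "honest_strategy (V i) (t\<lparr>select := (select t)(D k := 0)\<rparr>)"
        using honest_select_update[OF t(1)] least[OF k] Suc by simp
      then show ?thesis using t(2) Suc by (intro exI[of _ "t\<lparr>select := (select t)(D k := 0)\<rparr>"]) simp
    qed
  qed
  then obtain \<sigma> where \<sigma>: "\<And>i. i < n \<Longrightarrow> honest_strategy (V i) (\<sigma> i)"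
      "\<And>i. Suc i < n \<Longrightarrow> mark (\<sigma> i) (n - i) (R i) = D i"
      "\<And>i. Suc i < n \<Longrightarrow> select (\<sigma> (Suc i)) (D i) = 0"
    by (metis Suc_lessD)
  \<comment> \<open>By induction along the play, the inputs that actually occur are the overwritten
    ones.\<close>
  have r: "remaining n \<sigma> i = R i" if "i < n" for i
    using that by (induction i) (auto simp: R0 RS \<sigma> chosen_def)
  show thesis
  proof (rule that)
    show "honest_profile (mark_and_choose n) V \<sigma>" using V \<sigma>(1) by (simp add: honest_profile_def)
    show "allocate n \<sigma> i = D i ! 0" if "Suc i < n" for i
      using that by (simp add: allocate_def r \<sigma> chosen_def)
  qed (rule r)
qed

text \<open>The common shape of the plays constructed below: player 0 marks \<open>S\<close>, later
  players keep to the part of \<open>T\<close> not yet given away. The conditions on players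
  \<open>i > 0\<close> therefore concern only indices from \<open>i\<close> on, and
  \<open>S ! 0 = T ! 0\<close> makes the two divisions fit together.\<close>

lemma honest_profile_two_divisions:
  assumes n: "2 \<le> n" and V: "\<And>i. i < n \<Longrightarrow> is_valuation (V i)"
    and S: "divides cake n S" and T: "divides cake n T" and ST: "S ! 0 = T ! 0"
    and eq0: "\<forall>P\<in>set S. \<forall>Q\<in>set S. V 0 P = V 0 Q" and least0: "\<forall>P\<in>set S. V 1 (S ! 0) \<le> V 1 P"
    and eq: "\<And>i j k. 0 < i \<Longrightarrow> Suc i < n \<Longrightarrow> i \<le> j \<Longrightarrow> j < n \<Longrightarrow> i \<le> k \<Longrightarrow> k < n \<Longrightarrow>
      V i (T ! j) = V i (T ! k)"
    and least: "\<And>i j. 0 < i \<Longrightarrow> Suc i < n \<Longrightarrow> i \<le> j \<Longrightarrow> j < n \<Longrightarrow>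
      V (Suc i) (T ! i) \<le> V (Suc i) (T ! j)"
  obtains \<sigma> where "honest_profile (mark_and_choose n) V \<sigma>"
    "\<And>i. i < n \<Longrightarrow> allocate n \<sigma> i = T ! i"
proof -
  let ?D = "\<lambda>i. if i = 0 then S else drop i T" and ?R = "\<lambda>i. \<Union>(set (drop i T))"
  have l: "length T = n" "\<Union>(set T) = cake" using T unfolding divides_def by auto
  have set_D: "\<exists>j. i \<le> j \<and> j < n \<and> P = T ! j" if P: "P \<in> set (drop i T)" for i P
  proof -
    obtain k where "k < length (drop i T)" "P = drop i T ! k" using P by (auto simp: in_set_conv_nth)
    then show ?thesis using l by (intro exI[of _ "i + k"]) simp
  qed
  obtain \<sigma> where \<sigma>: "honest_profile (mark_and_choose n) V \<sigma>"
    "\<And>i. Suc i < n \<Longrightarrow> allocate n \<sigma> i = ?D i ! 0" "\<And>i. i < n \<Longrightarrow> remaining n \<sigma> i = ?R i"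
  proof (rule honest_profile_realizing[of n V ?R ?D])
    fix i assume i: "Suc i < n"
    show "divides (?R i) (n - i) (?D i)"
      using S divides_drop[OF T, of i] i l(2) by simp
    show "?R (Suc i) = ?R i - ?D i ! 0"
      using divides_Union_drop_Suc[OF T, of i] ST i l by simp
    show "\<forall>P\<in>set (?D i). \<forall>Q\<in>set (?D i). V i P = V i Q"
    proof (cases "i = 0")
      case True
      show ?thesis unfolding True if_P[OF refl] by (rule eq0)
    next
      case False
      have "V i P = V i Q" if P: "P \<in> set (drop i T)" and Q: "Q \<in> set (drop i T)" for P Q
      proof -
        obtain j k where "i \<le> j" "j < n" "P = T ! j" "i \<le> k" "k < n" "Q = T ! k"
          using set_D[OF P] set_D[OF Q] by auto
        then show ?thesis using eq[OF _ i, of j k] False by simp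
      qed
      then show ?thesis unfolding if_not_P[OF False] by blast
    qed
    show "\<forall>P\<in>set (?D i). V (Suc i) (?D i ! 0) \<le> V (Suc i) P"
    proof (cases "i = 0")
      case False
      then have "?D i ! 0 = T ! i" using i l by simp
      moreover have "V (Suc i) (T ! i) \<le> V (Suc i) P" if P: "P \<in> set (drop i T)" for P
      proof -
        obtain j where "i \<le> j" "j < n" "P = T ! j" using set_D[OF P] by auto
        then show ?thesis using least[OF _ i, of j] False by simp
      qed
      ultimately show ?thesis using False by simp
    qed (use least0 in simp)
  qed (use V l in auto)
  show thesis
  proof (rule that[OF \<sigma>(1)])
    fix i assume i: "i < n"
    show "allocate n \<sigma> i = T ! i"
    proof (cases "Suc i < n")
      case True
      then show ?thesis using \<sigma>(2)[OF True] ST l by simp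
    next
      case False
      then have "drop i T = [T ! i]" using i l Cons_nth_drop_Suc[of i T] by simp
      then show ?thesis using \<sigma>(3)[OF i] False by (simp add: allocate_def)
    qed
  qed
qed

section \<open>Valuations given by length\<close>

definition length_within :: "real set \<Rightarrow> valuation" where
  "length_within A P = measure lborel (P \<inter> A)"

lemma piece_borel: "piece P \<Longrightarrow> P \<in> sets borel"
  using real_interval_borel_measurable unfolding piece_def by (meson sets.finite_Union subsetI)

lemma piece_emeasure_finite: "piece P \<Longrightarrow> emeasure lborel (P \<inter> A) < \<infinity>"
  unfolding piece_def by (intro emeasure_bounded_finite bounded_subset[OF bounded_closed_interval]) auto

lemma length_within_Un:
  assumes "A \<in> sets borel" "piece P" "piece Q" "P \<inter> Q = {}"
  shows "length_within A (P \<union> Q) = length_within A P + length_within A Q"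
proof -
  have "measure lborel ((P \<inter> A) \<union> (Q \<inter> A)) = measure lborel (P \<inter> A) + measure lborel (Q \<inter> A)"
    using assms piece_emeasure_finite[OF assms(2), of A] piece_emeasure_finite[OF assms(3), of A]
    by (intro measure_Union) (auto intro: piece_borel)
  then show ?thesis unfolding length_within_def by (simp add: Int_Un_distrib2)
qed

text \<open>The distribution function \<open>G\<close> is 1-Lipschitz, as restriction to
  \<open>A\<close> cannot increase length. By \<open>Icc\<close> it determines the values of closed
  intervals, which gives joint continuity in both end points.\<close>

lemma is_valuation_length_within:
  assumes A: "A \<in> sets borel" and pos: "0 < length_within A cake"
  shows "is_valuation (length_within A)"
proof -
  define G where "G x = length_within A {0..x}" for x
  have Icc: "length_within A {a..b} = G b - G a" if ab: "0 \<le> a" "a \<le> b" "b \<le> 1" for a b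
  proof -
    have p: "piece {0..a}" "piece {a<..b}" "piece {a}"
      using ab by (auto intro!: piece_interval piece_point simp: is_interval_cc is_interval_oc)
    have "{0..a} \<union> {a<..b} = {0..b}" "{a} \<union> {a<..b} = {a..b}" "{0..a} \<inter> {a<..b} = {}" using ab by auto
    then have "G b = G a + length_within A {a<..b}"
      "length_within A {a..b} = length_within A {a} + length_within A {a<..b}"
      using length_within_Un[OF A p(1,2)] length_within_Un[OF A p(3,2)] unfolding G_def by auto
    moreover have "length_within A {a} = 0"
      unfolding length_within_def by (cases "a \<in> A") auto
    ultimately show ?thesis by simp
  qed
  have G_le: "0 \<le> G b - G a \<and> G b - G a \<le> b - a" if ab: "0 \<le> a" "a \<le> b" "b \<le> 1" for a b
  proof -
    have "measure lborel ({a..b} \<inter> A) \<le> measure lborel {a..b}"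
      using A ab by (intro measure_mono_fmeasurable) (auto intro: fmeasurableI)
    then have "length_within A {a..b} \<le> b - a" unfolding length_within_def using ab by simp
    then show ?thesis using Icc[OF ab] unfolding length_within_def by (metis measure_nonneg)
  qed
  have "dist (G y) (G x) \<le> dist y x" if "x \<in> {0..1}" "y \<in> {0..1}" for x y
    using G_le[of x y] G_le[of y x] that by (cases "x \<le> y") (auto simp: dist_real_def)
  then have G: "continuous_on {0..1} G"
    unfolding continuous_on_iff by (meson le_less_trans)
  let ?D = "{(a, b). 0 \<le> a \<and> a \<le> b \<and> b \<le> (1::real)}"
  have "continuous_on ?D (\<lambda>p. G (snd p) - G (fst p))"
    by (intro continuous_intros continuous_on_compose2[OF G]) auto
  then have "continuous_on ?D (\<lambda>(a, b). length_within A {a..b})"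
    by (rule continuous_on_eq) (auto simp: Icc)
  then show ?thesis
    unfolding is_valuation_def using length_within_Un[OF A] pos
    by (auto simp: length_within_def)
qed

text \<open>With several summands this builds the valuation behind surjectivity; with one it covers
  rescaling.\<close>

lemma is_valuation_weighted_sum:
  assumes "finite K" "K \<noteq> {}" "\<And>k. k \<in> K \<Longrightarrow> is_valuation (v k) \<and> 0 < c k"
  shows "is_valuation (\<lambda>P. \<Sum>k\<in>K. c k * v k P)"
proof -
  have "continuous_on {(a, b). 0 \<le> a \<and> a \<le> b \<and> b \<le> 1} (\<lambda>p. \<Sum>k\<in>K. c k * (case p of (a, b) \<Rightarrow> v k {a..b}))"
    using assms(3) unfolding is_valuation_def by (intro continuous_on_sum continuous_on_mult_left) blast
  then have "continuous_on {(a, b). 0 \<le> a \<and> a \<le> b \<and> b \<le> 1} (\<lambda>(a, b). \<Sum>k\<in>K. c k * v k {a..b})"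
    by (rule continuous_on_eq) auto
  moreover have "0 \<le> (\<Sum>k\<in>K. c k * v k P)" if "piece P" for P
  proof (intro sum_nonneg)
    fix k assume "k \<in> K"
    then show "0 \<le> c k * v k P"
      using assms(3) valuation_nonneg[OF _ that] by (simp add: less_imp_le)
  qed
  moreover have "(\<Sum>k\<in>K. c k * v k (P \<union> Q)) = (\<Sum>k\<in>K. c k * v k P) + (\<Sum>k\<in>K. c k * v k Q)"
    if "piece P \<and> piece Q \<and> P \<inter> Q = {}" for P Q
    unfolding sum.distrib[symmetric] distrib_left[symmetric]
    using that assms(3) by (intro sum.cong) (auto simp: valuation_Un)
  moreover have "0 < (\<Sum>k\<in>K. c k * v k cake)"
    using assms unfolding is_valuation_def by (intro sum_pos mult_pos_pos) auto
  ultimately show ?thesis unfolding is_valuation_def by simp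
qed

section \<open>Scale invariance and surjectivity\<close>

lemma scale_invariant_mark_and_choose: "scale_invariant (mark_and_choose n)"
  unfolding scale_invariant_def mark_and_choose_simps
proof (intro allI impI)
  fix V :: "nat \<Rightarrow> valuation" and i and c :: real
  assume V: "\<forall>i<n. is_valuation (V i)" and i: "i < n" and c: "0 < c"
  have "is_valuation (\<lambda>P. c * V i P)"
    using is_valuation_weighted_sum[of "{()}" "\<lambda>_. V i" "\<lambda>_. c"] V i c by simp
  \<comment> \<open>Honesty only compares values of pieces, and such comparisons survive a positive
    factor.\<close>
  moreover have "honest_strategy (\<lambda>P. c * V i P) s \<longleftrightarrow> honest_strategy (V i) s" for s
    unfolding honest_strategy_def using c by simp
  ultimately have "honest_profile (mark_and_choose n) (V(i := \<lambda>P. c * V i P)) \<sigma> \<longleftrightarrow>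
      honest_profile (mark_and_choose n) V \<sigma>" for \<sigma>
    unfolding honest_profile_def using V i by auto
  then show "outcomes (mark_and_choose n) (V(i := \<lambda>P. c * V i P)) = outcomes (mark_and_choose n) V"
    unfolding outcomes_def by simp
qed

text \<open>All players share one valuation under which every slice is worth 1. The slices still
  present are then an honest marking at every stage, and every selection is a tie.\<close>

lemma surjective_mark_and_choose:
  assumes n: "2 \<le> n"
  shows "surjective (mark_and_choose n)"
  unfolding surjective_def mark_and_choose_simps
proof (intro allI impI)
  fix S assume S: "divides cake n S \<and> (\<forall>P\<in>set S. is_interval P \<and> interior P \<noteq> {})"
  have p: "piece (S ! k)" "S ! k \<subseteq> cake" "interior (S ! k) \<noteq> {}" if "k < n" for k
    using S that unfolding divides_def piece_def by (metis nth_mem)+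
  let ?\<mu> = "\<lambda>k. measure lborel (S ! k)"
  \<comment> \<open>A nonempty interior excludes null sets, so each slice can be normalized by its
    length.\<close>
  have pos: "0 < ?\<mu> k" if "k < n" for k
  proof -
    have "\<not> negligible (S ! k)"
      using p(3)[OF that] open_not_negligible negligible_subset interior_subset open_interior by metis
    then have "emeasure lborel (S ! k) \<noteq> 0"
      using piece_borel[OF p(1)[OF that]] by (simp add: negligible_iff_null_sets null_sets_def)
    then show ?thesis
      using piece_emeasure_finite[OF p(1)[OF that], of UNIV] by (simp add: measure_def enn2real_positive_iff less_top zero_less_iff_neq_zero)
  qed
  define v where "v P = (\<Sum>k<n. 1 / ?\<mu> k * length_within (S ! k) P)" for P
  have "is_valuation (length_within (S ! k)) \<and> 0 < 1 / ?\<mu> k" if "k < n" for k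
    using pos[OF that] p[OF that]
    by (auto intro!: is_valuation_length_within piece_borel simp: length_within_def inf_absorb2)
  then have v: "is_valuation v"
    unfolding v_def using n by (intro is_valuation_weighted_sum) (auto simp: lessThan_empty_iff)
  have vS: "v (S ! j) = 1" if j: "j < n" for j
  proof -
    have "length_within (S ! k) (S ! j) = (if k = j then ?\<mu> j else 0)" if "k < n" for k
      using S that j unfolding length_within_def divides_def disjoint_family_on_def by auto
    then have "v (S ! j) = (\<Sum>k<n. if k = j then 1 else 0)"
      unfolding v_def using pos[OF j] by (intro sum.cong) auto
    then show ?thesis using j by simp
  qed
  have vS': "v P = 1" if "P \<in> set S" for P
    using that vS S unfolding divides_def by (metis in_set_conv_nth)
  obtain \<sigma> where "honest_profile (mark_and_choose n) (\<lambda>_. v) \<sigma>" "\<And>i. i < n \<Longrightarrow> allocate n \<sigma> i = S ! i"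
    using S n by (rule_tac honest_profile_two_divisions[of n "\<lambda>_. v" S S]) (auto simp: v vS vS')
  then show "\<exists>V \<sigma> \<pi>. honest_profile (mark_and_choose n) V \<sigma> \<and> bij_betw \<pi> {..<n} {..<n} \<and>
      (\<forall>i<n. allocate n \<sigma> i = S ! \<pi> i)"
    by (intro exI[of _ "\<lambda>_. v"] exI[of _ \<sigma>] exI[of _ id]) auto
qed

section \<open>A last player left with a worthless piece\<close>

definition slice :: "(nat \<Rightarrow> real) \<Rightarrow> nat \<Rightarrow> real set" where
  "slice x k = (if k = 0 then {x 0..x 1} else {x k<..x (Suc k)})"

definition slices :: "(nat \<Rightarrow> real) \<Rightarrow> nat \<Rightarrow> real set list" where
  "slices x m = map (slice x) [0..<m]"

lemma slices_simps [simp]: "length (slices x m) = m" "set (slices x m) = slice x ` {..<m}"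
  "k < m \<Longrightarrow> slices x m ! k = slice x k"
  by (auto simp: slices_def)

lemma divides_slices:
  assumes "incseq x" "x 0 = 0" "x m = 1"
  shows "divides cake m (slices x m)"
proof -
  have "\<Union>(slice x ` {..<k}) = {0..x k}" if "0 < k" for k
    using that
  proof (induction k rule: nat_induct_non_zero)
    case (Suc k)
    have "x 0 \<le> x k" "x k \<le> x (Suc k)" using assms(1) by (auto simp: incseq_def)
    then show ?case using Suc assms(2) by (auto simp: lessThan_Suc slice_def)
  qed (simp add: slice_def assms(2) lessThan_Suc)
  moreover have "0 < m" using assms(2,3) by (cases m) auto
  ultimately have U: "\<Union>(slice x ` {..<m}) = cake" using assms(3) by metis
  have "slice x j \<inter> slice x k = {}" if "j < k" for j k
  proof -
    have "x (Suc j) \<le> x k" using assms(1) that by (auto simp: incseq_def)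
    then show ?thesis using that by (auto simp: slice_def)
  qed
  then have "slice x j \<inter> slice x k = {}" if "j \<noteq> k" for j k
    using that by (metis Int_commute linorder_neqE_nat)
  then have "disjoint_family_on (\<lambda>i. slices x m ! i) {..<m}"
    by (auto simp: disjoint_family_on_def)
  moreover have "piece (slice x k)" if "k < m" for k
    using U that by (intro piece_interval) (auto simp: slice_def is_interval_cc is_interval_oc)
  ultimately show ?thesis using U unfolding divides_def by auto
qed

text \<open>Lets the equal slices be handed out from right to left, against the order that
  \<open>sequential\<close> demands.\<close>

lemma divides_rev:
  assumes "divides R m Ps"
  shows "divides R m (rev Ps)"
  using assms unfolding divides_def disjoint_family_on_def
  by (auto simp: rev_nth)

lemma length_within_slice:
  assumes "incseq x"
  shows "length_within UNIV (slice x k) = x (Suc k) - x k"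
  using assms by (auto simp: length_within_def slice_def incseq_def)

lemma length_within_slice_before:
  assumes "x (Suc k) \<le> c"
  shows "length_within {c<..1} (slice x k) = 0"
proof -
  have "slice x k \<inter> {c<..1} = {}" using assms by (auto simp: slice_def split: if_splits)
  then show ?thesis by (simp add: length_within_def)
qed

lemma length_within_slice_after:
  assumes "incseq x" "0 < k" "c \<le> x k" "x (Suc k) \<le> 1"
  shows "length_within {c<..1} (slice x k) = x (Suc k) - x k"
proof -
  have "slice x k \<inter> {c<..1} = slice x k" using assms by (auto simp: slice_def split: if_splits)
  then show ?thesis using length_within_slice[OF assms(1), of k] by (simp add: length_within_def)
qed

lemma length_within_cake:
  "length_within UNIV cake = 1" "0 \<le> c \<Longrightarrow> c \<le> 1 \<Longrightarrow> length_within {c<..1} cake = 1 - c"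
proof -
  show "length_within {c<..1} cake = 1 - c" if "0 \<le> c" "c \<le> 1"
  proof -
    have "cake \<inter> {c<..1} = {c<..1}" using that by auto
    then show ?thesis using that by (simp add: length_within_def)
  qed
qed (simp add: length_within_def)

lemma is_valuation_length: "is_valuation (length_within UNIV)"
  by (rule is_valuation_length_within) (simp_all add: length_within_cake)

lemma is_valuation_length_tail: "0 \<le> c \<Longrightarrow> c < 1 \<Longrightarrow> is_valuation (length_within {c<..1})"
  by (rule is_valuation_length_within) (simp_all add: length_within_cake)

abbreviation equal_cuts :: "nat \<Rightarrow> nat \<Rightarrow> real" where
  "equal_cuts n \<equiv> \<lambda>k. real k / real n"

lemma incseq_equal_cuts: "incseq (equal_cuts n)"
  by (auto simp: incseq_def divide_right_mono)

lemma equal_cuts_diff: "equal_cuts n (Suc k) - equal_cuts n k = 1 / real n"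
  by (simp add: diff_divide_distrib[symmetric])

lemma length_equal_slice: "length_within UNIV (slice (equal_cuts n) k) = 1 / real n"
  using length_within_slice[OF incseq_equal_cuts] equal_cuts_diff by simp

lemma divides_equal_slices: "0 < n \<Longrightarrow> divides cake n (slices (equal_cuts n) n)"
  by (intro divides_slices incseq_equal_cuts) auto

text \<open>The rightmost slice, the only one the last player values, is given away first. Since
  \<open>3 \<le> n\<close>, it is selected by a player other than the last one, who is indifferent
  between the slices.\<close>

lemma last_player_worthless_share:
  assumes n: "3 \<le> n"
  defines "V \<equiv> (\<lambda>i. length_within (if i = n - 1 then {equal_cuts n (n - 1)<..1} else UNIV))"
  obtains \<sigma> where "honest_profile (mark_and_choose n) V \<sigma>"
    "\<And>i. i < n \<Longrightarrow> allocate n \<sigma> i = slice (equal_cuts n) (n - 1 - i)"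
proof -
  let ?x = "equal_cuts n" and ?S = "rev (slices (equal_cuts n) n)"
  have d: "divides cake n ?S" using n by (intro divides_rev divides_equal_slices) simp
  have nth: "?S ! i = slice ?x (n - 1 - i)" if "i < n" for i using that by (simp add: rev_nth)
  have V_rest: "V i = length_within UNIV" if "i \<noteq> n - 1" for i using that by (simp add: V_def)
  \<comment> \<open>Both pieces from which the last player selects are of this kind, so that
    selection is a tie.\<close>
  have V_last: "V (n - 1) (slice ?x k) = 0" if "Suc k < n" for k
    unfolding V_def if_P[OF refl] using that by (intro length_within_slice_before divide_right_mono) auto
  obtain \<sigma> where "honest_profile (mark_and_choose n) V \<sigma>" "\<And>i. i < n \<Longrightarrow> allocate n \<sigma> i = ?S ! i"
  proof (rule honest_profile_two_divisions[of n V ?S ?S])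
    show "is_valuation (V i)" if "i < n" for i
      using n by (auto simp: V_def is_valuation_length intro!: is_valuation_length_tail)
    have "V 0 P = 1 / n \<and> V 1 P = 1 / n" if "P \<in> set ?S" for P
      using that n V_rest[of 0] V_rest[of 1] by (auto simp: length_equal_slice)
    then show "\<forall>P\<in>set ?S. \<forall>Q\<in>set ?S. V 0 P = V 0 Q" "\<forall>P\<in>set ?S. V 1 (?S ! 0) \<le> V 1 P"
      using nth_mem[of 0 ?S] n by auto
    show "V i (?S ! j) = V i (?S ! k)" if "0 < i" "Suc i < n" "j < n" "k < n" for i j k
      using that V_rest[of i] by (simp add: nth length_equal_slice)
    show "V (Suc i) (?S ! i) \<le> V (Suc i) (?S ! j)" if i: "0 < i" "Suc i < n" and j: "i \<le> j" "j < n" for i j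
    proof (cases "Suc i = n - 1")
      case True
      then show ?thesis using V_last[of "n - 1 - i"] V_last[of "n - 1 - j"] i j by (simp add: nth)
    next
      case False
      then show ?thesis using V_rest[of "Suc i"] i j by (simp add: nth length_equal_slice)
    qed
  qed (use n d in auto)
  then show thesis using nth by (intro that[of \<sigma>]) auto
qed

text \<open>One play refutes all five: the last player ends with value 0 and the others with
  \<open>1 / n\<close>, the first player holds all that the last one values, and the shares run from
  right to left.\<close>

lemma worthless_share_failures:
  assumes n: "3 \<le> n"
  shows "\<not> proportional (mark_and_choose n)" "\<not> envy_free (mark_and_choose n)"
    "\<not> equitable (mark_and_choose n)" "\<not> weakly_pareto_optimal (mark_and_choose n)"
    "\<not> sequential (mark_and_choose n)"
proof -
  let ?x = "equal_cuts n" and ?c = "equal_cuts n (n - 1)"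
  define V where "V = (\<lambda>i. length_within (if i = n - 1 then {?c<..1} else UNIV))"
  obtain \<sigma> where \<sigma>: "honest_profile (mark_and_choose n) V \<sigma>"
    "\<And>i. i < n \<Longrightarrow> allocate n \<sigma> i = slice ?x (n - 1 - i)"
    using last_player_worthless_share[OF n] unfolding V_def by blast
  have c: "1 - ?c = 1 / n" "0 \<le> ?c" "?c < 1" using n by (simp_all add: field_simps of_nat_diff)
  have V_rest: "V i = length_within UNIV" if "i \<noteq> n - 1" for i using that by (simp add: V_def)
  have V_last: "V (n - 1) = length_within {?c<..1}" by (simp add: V_def)
  have own_last: "V (n - 1) (allocate n \<sigma> (n - 1)) = 0"
    using \<sigma>(2)[of "n - 1"] n unfolding V_last
    by (simp add: length_within_slice_before divide_right_mono)
  have own_rest: "V i (allocate n \<sigma> i) = 1 / n" if "Suc i < n" for i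
    using \<sigma>(2)[of i] V_rest[of i] that by (simp add: length_equal_slice)
  show "\<not> proportional (mark_and_choose n)"
  proof
    assume "proportional (mark_and_choose n)"
    then have "1 / real n * V (n - 1) cake \<le> V (n - 1) (allocate n \<sigma> (n - 1))"
      using \<sigma>(1) n unfolding proportional_def by auto
    then show False unfolding own_last unfolding V_last length_within_cake(2)[OF c(2) less_imp_le[OF c(3)]] c(1)
      using n by (simp add: mult_le_0_iff)
  qed
  show "\<not> envy_free (mark_and_choose n)"
  proof
    assume "envy_free (mark_and_choose n)"
    then have "V (n - 1) (allocate n \<sigma> 0) \<le> V (n - 1) (allocate n \<sigma> (n - 1))"
      using \<sigma>(1) n unfolding envy_free_def by auto
    moreover have "V (n - 1) (allocate n \<sigma> 0) = ?x (Suc (n - 1)) - ?x (n - 1)"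
      using \<sigma>(2)[of 0] n unfolding V_last
      by (simp add: length_within_slice_after[OF incseq_equal_cuts])
    ultimately show False unfolding own_last equal_cuts_diff using n by simp
  qed
  show "\<not> equitable (mark_and_choose n)"
  proof
    assume "equitable (mark_and_choose n)"
    then have "V 0 (allocate n \<sigma> 0) = V (n - 1) (allocate n \<sigma> (n - 1))"
      using \<sigma>(1) n unfolding equitable_def by auto
    then show False using own_last own_rest[of 0] n by simp
  qed
  show "\<not> weakly_pareto_optimal (mark_and_choose n)"
  proof
    assume po: "weakly_pareto_optimal (mark_and_choose n)"
    \<comment> \<open>The last player gets the final piece of length \<open>1 / (2 n)\<close>, the others equal parts of the rest.\<close>
    define d where "d = (2 * real n - 1) / (2 * real n * (real n - 1))"
    define y where "y k = (if k < n then real k * d else 1)" for k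
    have n0: "2 < real n" using n by linarith
    have d: "1 / n < d" "(real n - 1) * d = 1 - 1 / (2 * real n)"
      unfolding d_def using n0 by (simp_all add: field_simps)
    \<comment> \<open>The last cut lies beyond \<open>?c\<close>, so the final slice lies inside the
      part that the last player values.\<close>
    have nd: "(real n - 1) * d < 1" "?c < (real n - 1) * d"
      unfolding d(2) using n0 by (simp_all add: field_simps of_nat_diff)
    have d0: "0 < d" using d(1) n0 by (smt (verit) divide_pos_pos)
    have y: "incseq y"
    proof (rule incseq_SucI)
      fix k
      have "real k * d \<le> (real n - 1) * d" if "k < n"
        using d0 that by (intro mult_right_mono) auto
      then show "y k \<le> y (Suc k)" unfolding y_def using nd d0 by (auto simp: algebra_simps)
    qed
    have "divides cake n (slices y n)" using n by (intro divides_slices y) (auto simp: y_def)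
    moreover have "V i (allocate n \<sigma> i) < V i (slices y n ! i)" if i: "i < n" for i
    proof (cases "i = n - 1")
      case True
      have "V i (slices y n ! i) = 1 - (real n - 1) * d"
        using True n nd unfolding V_last True
        by (simp add: length_within_slice_after[OF y] y_def of_nat_diff)
      then show ?thesis using own_last nd True by simp
    next
      case False
      then have "Suc i < n" using i by simp
      then show ?thesis
        using own_rest[of i] V_rest[of i] False d(1) by (simp add: length_within_slice[OF y] y_def algebra_simps)
    qed
    ultimately show False
      using po \<sigma>(1) unfolding weakly_pareto_optimal_def mark_and_choose_simps by blast
  qed
  show "\<not> sequential (mark_and_choose n)"
  proof
    assume "sequential (mark_and_choose n)"
    then have "\<forall>i<n. \<forall>j<n. 2 * i + 2 < 2 * j + 2 \<longrightarrow>
        (\<forall>x\<in>allocate n \<sigma> i. \<forall>y\<in>allocate n \<sigma> j. x \<le> y)"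
      using \<sigma>(1) unfolding sequential_def mark_and_choose_simps by blast
    from this[rule_format, of 0 1] have "\<forall>x\<in>allocate n \<sigma> 0. \<forall>y\<in>allocate n \<sigma> 1. x \<le> y"
      using n by simp
    moreover have "allocate n \<sigma> 0 = slice ?x (n - 1)" "allocate n \<sigma> 1 = slice ?x (n - 2)"
      using \<sigma>(2)[of 0] \<sigma>(2)[of 1] n by (simp_all add: numeral_2_eq_2)
    ultimately have "\<forall>x\<in>slice ?x (n - 1). \<forall>y\<in>slice ?x (n - 2). x \<le> y" by metis
    \<comment> \<open>Right end points belong to their slices, so two cuts witness the wrong
      order.\<close>
    moreover have "?x n \<in> slice ?x (n - 1)" "?x (n - 1) \<in> slice ?x (n - 2)"
      using n by (auto simp: slice_def divide_strict_right_mono Suc_diff_Suc)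
    ultimately have "?x n \<le> ?x (n - 1)" by blast
    then show False using n by (simp add: divide_simps)
  qed
qed

text \<open>Used in contraposed form; \<open>0 < players p\<close> supplies the player who gains
  strictly.\<close>

lemma pareto_optimal_imp_weakly:
  "0 < players p \<Longrightarrow> pareto_optimal p \<Longrightarrow> weakly_pareto_optimal p"
  unfolding pareto_optimal_def weakly_pareto_optimal_def by (meson less_imp_le)

section \<open>A first player envying the second\<close>

text \<open>
  Each slice but the first takes an equal share of the last \<open>n\<close>-th of the cake; slice 1 also
  reaches to the left down to the free parameter \<open>a\<close>.
\<close>

definition tail_cuts :: "nat \<Rightarrow> real \<Rightarrow> nat \<Rightarrow> real" where
  "tail_cuts n a k = (if k = 0 then 0 else if k = 1 then a
     else (real n - 1) / real n + (real k - 1) / (real n * (real n - 1)))"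

lemma tail_cuts_simps [simp]:
  "tail_cuts n a 0 = 0" "tail_cuts n a (Suc 0) = a"
  by (simp_all add: tail_cuts_def)

lemma tail_cuts_last: "2 \<le> n \<Longrightarrow> tail_cuts n a n = 1"
  by (simp add: tail_cuts_def field_simps)

lemma tail_cuts_ge: "2 \<le> k \<Longrightarrow> 2 \<le> n \<Longrightarrow> (real n - 1) / real n \<le> tail_cuts n a k"
  by (simp add: tail_cuts_def)

lemma incseq_tail_cuts:
  assumes "2 \<le> n" "0 \<le> a" "a \<le> (real n - 1) / real n"
  shows "incseq (tail_cuts n a)"
proof (rule incseq_SucI)
  fix k :: nat
  consider "k = 0" | "k = 1" | "2 \<le> k" by linarith
  then show "tail_cuts n a k \<le> tail_cuts n a (Suc k)"
  proof cases
    case 1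
    then show ?thesis using assms by simp
  next
    case 2
    then show ?thesis using tail_cuts_ge[of 2 n a] assms by (simp add: numeral_2_eq_2)
  next
    case 3
    then show ?thesis using assms(1) by (simp add: tail_cuts_def divide_right_mono)
  qed
qed

lemma divides_tail_slices:
  assumes "2 \<le> n" "0 \<le> a" "a \<le> (real n - 1) / real n"
  shows "divides cake n (slices (tail_cuts n a) n)"
  by (rule divides_slices[OF incseq_tail_cuts[OF assms]]) (simp_all add: tail_cuts_last[OF assms(1)])

text \<open>Slice 1 needs its own case: it may begin before the tail, at \<open>a\<close>, but only
  its part inside the tail counts. The value is thus independent of \<open>a\<close>, which is
  \<open>1 / n\<close> in the honest play and \<open>(real n - 1) / real n\<close> in the
  lie.\<close>

lemma length_tail_slice:
  assumes n: "2 \<le> n" and a: "0 \<le> a" "a \<le> (real n - 1) / real n" and k: "k < n"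
  shows "length_within {(real n - 1) / real n<..1} (slice (tail_cuts n a) k) =
    (if k = 0 then 0 else 1 / (real n * (real n - 1)))"
proof -
  let ?c = "(real n - 1) / real n" and ?y = "tail_cuts n a"
  have inc: "incseq ?y" by (rule incseq_tail_cuts[OF n a])
  have le1: "?y (Suc k) \<le> 1"
    using inc k tail_cuts_last[OF n, of a] unfolding incseq_def by (metis Suc_leI)
  consider "k = 0" | "k = 1" | "2 \<le> k" by linarith
  then show ?thesis
  proof cases
    case 1
    then show ?thesis using length_within_slice_before[of ?y 0 ?c] a(2) by simp
  next
    case 2
    have y2: "?y (Suc 1) = ?c + 1 / (real n * (real n - 1))" by (simp add: tail_cuts_def)
    have "slice ?y 1 \<inter> {?c<..1} = {?c<..?y (Suc 1)}"
      using a(2) le1 2 by (auto simp: slice_def)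
    then show ?thesis using 2 y2 n by (simp add: length_within_def)
  next
    case 3
    then have "?y (Suc k) - ?y k = 1 / (real n * (real n - 1))"
      by (simp add: tail_cuts_def diff_divide_distrib[symmetric])
    then show ?thesis
      using length_within_slice_after[OF inc _ tail_cuts_ge[OF 3 n] le1] 3 by simp
  qed
qed

text \<open>
  The first player marks the equal slices, and the others keep to the tail slices; the two
  divisions share their first slice, which is the one given to the first player.
\<close>

lemma forward_envy_example:
  assumes n: "3 \<le> n"
  defines "V \<equiv> (\<lambda>i. length_within (if i = 0 then UNIV else {(real n - 1) / real n<..1}))"
  obtains \<sigma> where "honest_profile (mark_and_choose n) V \<sigma>"
    "\<And>i. i < n \<Longrightarrow> allocate n \<sigma> i = slice (tail_cuts n (1 / n)) i"
proof -
  let ?S = "slices (equal_cuts n) n" and ?T = "slices (tail_cuts n (1 / n)) n"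
  have n2: "2 \<le> n" and a: "0 \<le> 1 / real n" "1 / real n \<le> (real n - 1) / real n"
    using n by (simp_all add: divide_right_mono)
  have V: "V i = length_within {(real n - 1) / real n<..1}" if "0 < i" for i
    using that by (simp add: V_def)
  \<comment> \<open>Once slice 0 is gone, all players but the first are indifferent between the
    remaining slices.\<close>
  have T: "V i (?T ! k) = 1 / (real n * (real n - 1))" if "0 < i" "0 < k" "k < n" for i k
    unfolding V[OF that(1)] using length_tail_slice[OF n2 a that(3)] that by simp
  \<comment> \<open>The choice \<open>1 / n\<close> of the free parameter makes the two divisions
    agree here.\<close>
  have first: "slice (equal_cuts n) 0 = slice (tail_cuts n (1 / n)) 0"
    by (simp add: slice_def)
  obtain \<sigma> where "honest_profile (mark_and_choose n) V \<sigma>" "\<And>i. i < n \<Longrightarrow> allocate n \<sigma> i = ?T ! i"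
  proof (rule honest_profile_two_divisions[of n V ?S ?T])
    show "is_valuation (V i)" for i
      using n by (auto simp: V_def is_valuation_length intro!: is_valuation_length_tail)
    show "divides cake n ?S" using n by (intro divides_equal_slices) simp
    show "divides cake n ?T" by (rule divides_tail_slices[OF n2 a])
    show "?S ! 0 = ?T ! 0" using n first by simp
    show "\<forall>P\<in>set ?S. \<forall>Q\<in>set ?S. V 0 P = V 0 Q" by (auto simp: V_def length_equal_slice)
    have "V 1 (?S ! 0) = 0"
      using length_tail_slice[OF n2 a, of 0] n first V[of 1] by simp
    then show "\<forall>P\<in>set ?S. V 1 (?S ! 0) \<le> V 1 P"
      by (simp add: V_def length_within_def)
  qed (use n T in auto)
  then show thesis by (intro that[of \<sigma>]) auto
qed

lemma forward_envy_example_failures: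
  assumes n: "3 \<le> n"
  shows "\<not> forward_envy_free (mark_and_choose n)" "\<not> truthful (mark_and_choose n)"
    "\<not> order_monotonic (mark_and_choose n)"
proof -
  let ?c = "(real n - 1) / real n" and ?y = "tail_cuts n (1 / n)"
  define V where "V = (\<lambda>i::nat. length_within (if i = 0 then UNIV else {?c<..1}))"
  obtain \<sigma> where \<sigma>: "honest_profile (mark_and_choose n) V \<sigma>"
    "\<And>i. i < n \<Longrightarrow> allocate n \<sigma> i = slice ?y i"
    using forward_envy_example[OF n] unfolding V_def by blast
  have n2: "2 \<le> n" and n0: "2 < real n" and a: "0 \<le> 1 / real n" "1 / real n \<le> ?c"
    using n by (simp_all add: divide_right_mono)
  have c: "1 - ?c = 1 / n" "0 \<le> ?c" "?c \<le> 1" "1 / n < ?c" using n by (simp_all add: field_simps)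
  have V0: "V 0 = length_within UNIV" by (simp add: V_def)
  have V1: "V 1 = length_within {?c<..1}" by (simp add: V_def)
  have legal: "\<forall>i<n. legal_strategy (\<sigma> i)" by (rule honest_profile_legal[OF \<sigma>(1)])
  have h1: "is_valuation (V 1)" "honest_strategy (V 1) (\<sigma> 1)"
    using \<sigma>(1) n unfolding honest_profile_def by auto
  have own0: "V 0 (allocate n \<sigma> 0) = 1 / n"
    using \<sigma>(2)[of 0] n length_within_slice[OF incseq_tail_cuts[OF n2 a], of 0] unfolding V0 by simp
  show "\<not> forward_envy_free (mark_and_choose n)"
  proof
    assume "forward_envy_free (mark_and_choose n)"
    then have "V 0 (allocate n \<sigma> 1) \<le> V 0 (allocate n \<sigma> 0)"
      using \<sigma>(1) n unfolding forward_envy_free_def by auto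
    moreover have "V 0 (allocate n \<sigma> 1) = ?c + 1 / (real n * (real n - 1)) - 1 / n"
      using \<sigma>(2)[of 1] n length_within_slice[OF incseq_tail_cuts[OF n2 a], of 1]
      unfolding V0 by (simp add: tail_cuts_def)
    \<comment> \<open>With \<open>2 / n \<le> ?c\<close>, slice 1 is strictly longer than the
      \<open>1 / n\<close> held by the first player.\<close>
    moreover have "2 / n \<le> ?c" "0 < 1 / (real n * (real n - 1))"
      using n n0 by (simp_all add: divide_right_mono)
    ultimately show False unfolding own0 by simp
  qed
  show "\<not> truthful (mark_and_choose n)"
  proof
    assume t: "truthful (mark_and_choose n)"
    \<comment> \<open>The lie collects all that is worthless to the others in slice 0 by setting the
      free parameter to \<open>?c\<close>.\<close>
    let ?Z = "slices (tail_cuts n ?c) n"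
    let ?s = "(\<sigma> 0)\<lparr>mark := (mark (\<sigma> 0))(n := (mark (\<sigma> 0) n)(cake := ?Z))\<rparr>"
    let ?\<sigma> = "\<sigma>(0 := ?s)"
    have Z: "divides cake n ?Z" by (rule divides_tail_slices[OF n2 c(2) order_refl])
    have s: "legal_strategy ?s" using legal n by (intro legal_mark_update Z) simp
    have l: "\<forall>i<n. legal_strategy (?\<sigma> i)" using legal s by simp
    have m: "mark (?\<sigma> 0) (n - 0) (remaining n ?\<sigma> 0) = ?Z" by simp
    have Zk: "V 1 (slice (tail_cuts n ?c) k) = (if k = 0 then 0 else 1 / (real n * (real n - 1)))"
      if "k < n" for k
      unfolding V1 by (rule length_tail_slice[OF n2 c(2) order_refl that])
    have "V 1 (allocate n ?\<sigma> 0) \<le> V 1 (slice (tail_cuts n ?c) 0)"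
    proof (rule honest_chooser_least[OF l])
      show "slice (tail_cuts n ?c) 0 \<in> set (mark (?\<sigma> 0) (n - 0) (remaining n ?\<sigma> 0))"
        unfolding m using n by auto
    qed (use h1 n in auto)
    moreover have "allocate n ?\<sigma> 0 \<in> set ?Z"
      using allocate_in_marked[OF l, of 0, unfolded m] n by linarith
    then obtain k where k: "k < n" "allocate n ?\<sigma> 0 = slice (tail_cuts n ?c) k" by auto
    \<comment> \<open>Slice 0 is the only marked piece worthless to player 1, so its selection is
      forced and no tie-breaking enters.\<close>
    ultimately have "k = 0"
      using Zk[OF k(1)] Zk[of 0] n n0 by (auto split: if_splits simp: divide_le_0_iff mult_le_0_iff)
    then have "V 0 (allocate n ?\<sigma> 0) = ?c"
      using k length_within_slice[OF incseq_tail_cuts[OF n2 c(2) order_refl], of 0] unfolding V0 by simp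
    moreover have "V 0 (allocate n ?\<sigma> 0) \<le> V 0 (allocate n \<sigma> 0)"
      using t \<sigma>(1) s n unfolding truthful_def mark_and_choose_simps by auto
    ultimately show False unfolding own0 using c(4) by simp
  qed
  show "\<not> order_monotonic (mark_and_choose n)"
  proof
    assume "order_monotonic (mark_and_choose n)"
    \<comment> \<open>\<open>advance 1 0\<close> exchanges the first two players.\<close>
    then have le: "V 1 (allocate n \<sigma> 1) \<le> V 1 (allocate n (\<sigma> \<circ> advance 1 0) 0)"
      using \<sigma>(1) n unfolding order_monotonic_def by auto
    have "\<forall>i<n. legal_strategy ((\<sigma> \<circ> advance 1 0) i)"
      using legal n by (auto simp: advance_def)
    \<comment> \<open>As first marker, player 1 gets exactly an \<open>n\<close>-th of the whole
      cake's value, whatever the former first player now selects.\<close>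
    then have "V 1 (allocate n (\<sigma> \<circ> advance 1 0) 0) = V 1 cake / n"
      using honest_marker_value[OF h1(1), of n "\<sigma> \<circ> advance 1 0" 0] h1(2) n by (simp add: advance_def)
    also have "\<dots> = 1 / (real n * real n)"
      unfolding V1 length_within_cake(2)[OF c(2,3)] c(1) by simp
    also have "\<dots> < 1 / (real n * (real n - 1))"
      using n0 by (intro divide_strict_left_mono) auto
    also have "\<dots> = V 1 (allocate n \<sigma> 1)"
      using \<sigma>(2)[of 1] length_tail_slice[OF n2 a, of 1] n unfolding V1 by simp
    finally show False using le by simp
  qed
qed

theorem theorem5:
  fixes n :: nat
  assumes "n \<ge> 3"
  shows "forward_proportional (mark_and_choose n) \<and>
    immediately_envy_free (mark_and_choose n) \<and>
    weakly_truthful (mark_and_choose n) \<and>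
    surjective (mark_and_choose n) \<and>
    scale_invariant (mark_and_choose n) \<and>
    \<not> proportional (mark_and_choose n) \<and>
    \<not> envy_free (mark_and_choose n) \<and>
    \<not> forward_envy_free (mark_and_choose n) \<and>
    \<not> equitable (mark_and_choose n) \<and>
    \<not> pareto_optimal (mark_and_choose n) \<and>
    \<not> weakly_pareto_optimal (mark_and_choose n) \<and>
    \<not> truthful (mark_and_choose n) \<and>
    \<not> order_monotonic (mark_and_choose n) \<and>
    \<not> sequential (mark_and_choose n)"
  using assms forward_proportional_mark_and_choose immediately_envy_free_mark_and_choose
    weakly_truthful_mark_and_choose surjective_mark_and_choose[of n] scale_invariant_mark_and_choose
    worthless_share_failures[OF assms] forward_envy_example_failures[OF assms]
    pareto_optimal_imp_weakly[of "mark_and_choose n"]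
  by auto

end
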